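(* Let $G$ be a connected, triangle-free graph. Then $\mu(G)=3$ if and only if $G$ is a tree with exactly three leaves or $G$ is a frog graph.
   Context: All graphs are finite, simple, undirected. For a connected graph $G$ and $X\subseteq V(G)$, two vertices $x,y\in X$ are $X$-visible (mutually visible) if there exists a shortest $x,y$-path $P$ in $G$ with $V(P)\cap X=\{x,y\}$. $X$ is a mutual-visibility set if every two of its vertices are $X$-visible. The mutual-visibility number $\mu(G)$ is the maximum size of a mutual-visibility set of $G$. For a cycle $C$ (chordless, $n(C)\ge 3$ vertices), two vertices $u,v$ of $C$ are antipodal if $d_C(u,v)=\lfloor n(C)/2\rfloor$. A frog graph is obtained from a cycle $C$ and two paths $P_r$ and $P_s$ on $r\ge 1$ and $s\ge 1$ vertices as follows: choose two antipodal vertices $v^r,v^s$ of $C$ and identify $v^r$ with an end-vertex of $P_r$ and $v^s$ with an end-vertex of $P_s$ (the paths being otherwise disjoint from $C$ and each other). In particular every cycle is a frog graph (case $r=s=1$). *)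

theory Defs
  imports "Graph_Theory.Pair_Digraph" "Graph_Theory.Digraph_Component" "Graph_Theory.Vertex_Walk"
begin

text \<open>
  Finite simple undirected graphs are the symmetric loop-free pair digraphs of the locale
  \<^locale>\<open>pair_graph\<close>; an undirected edge is a pair of opposite arcs, and paths are given by their
  lists of vertices.
\<close>

definition path_between :: "'a pair_pre_digraph \<Rightarrow> 'a \<Rightarrow> 'a vwalk \<Rightarrow> 'a \<Rightarrow> bool" where
  "path_between G x p y \<longleftrightarrow> vpath p (with_proj G) \<and> hd p = x \<and> last p = y"

text \<open>Only meaningful if \<open>y\<close> is reachable from \<open>x\<close>.\<close>

definition graph_dist :: "'a pair_pre_digraph \<Rightarrow> 'a \<Rightarrow> 'a \<Rightarrow> nat" where
  "graph_dist G x y = (LEAST n. \<exists>p. path_between G x p y \<and> vwalk_length p = n)"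

definition shortest_path :: "'a pair_pre_digraph \<Rightarrow> 'a \<Rightarrow> 'a vwalk \<Rightarrow> 'a \<Rightarrow> bool" where
  "shortest_path G x p y \<longleftrightarrow> path_between G x p y \<and> vwalk_length p = graph_dist G x y"

definition mutually_visible :: "'a pair_pre_digraph \<Rightarrow> 'a set \<Rightarrow> 'a \<Rightarrow> 'a \<Rightarrow> bool" where
  "mutually_visible G X x y \<longleftrightarrow> (\<exists>p. shortest_path G x p y \<and> set p \<inter> X = {x, y})"

definition mutual_visibility_set :: "'a pair_pre_digraph \<Rightarrow> 'a set \<Rightarrow> bool" where
  "mutual_visibility_set G X \<longleftrightarrow>
     X \<subseteq> pverts G \<and> (\<forall>x\<in>X. \<forall>y\<in>X. x \<noteq> y \<longrightarrow> mutually_visible G X x y)"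

definition mutual_visibility_number :: "'a pair_pre_digraph \<Rightarrow> nat" where
  "mutual_visibility_number G = Max (card ` {X. mutual_visibility_set G X})"

definition triangle_free :: "'a pair_pre_digraph \<Rightarrow> bool" where
  "triangle_free G \<longleftrightarrow>
     \<not> (\<exists>u v w. (u, v) \<in> parcs G \<and> (v, w) \<in> parcs G \<and> (w, u) \<in> parcs G)"

text \<open>
  The library's \<open>forest\<close> and \<open>tree\<close> are not usable here: they treat the closed walk \<open>a, b, a\<close> along
  two opposite arcs as a cycle. In a simple graph a closed walk as in \<^const>\<open>pre_digraph.cycle\<close>
  is an undirected cycle exactly if its length is at least 3.
\<close>

definition undirected_tree :: "'a pair_pre_digraph \<Rightarrow> bool" where
  "undirected_tree G \<longleftrightarrow>
     connected (with_proj G) \<and> \<not> (\<exists>c. pre_digraph.cycle (with_proj G) c \<and> 3 \<le> length c)"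

definition leaves :: "'a pair_pre_digraph \<Rightarrow> 'a set" where
  "leaves G = {v \<in> pverts G. out_degree (with_proj G) v = 1}"

definition path_graph :: "'a list \<Rightarrow> 'a pair_pre_digraph" where
  "path_graph p = \<lparr> pverts = set p, parcs = symcl (set (vwalk_arcs p)) \<rparr>"

definition cycle_graph :: "'a list \<Rightarrow> 'a pair_pre_digraph" where
  "cycle_graph c = \<lparr> pverts = set c, parcs = symcl (set (vwalk_arcs (c @ [hd c]))) \<rparr>"

definition antipodal :: "'a pair_pre_digraph \<Rightarrow> 'a \<Rightarrow> 'a \<Rightarrow> bool" where
  "antipodal C u v \<longleftrightarrow>
     u \<in> pverts C \<and> v \<in> pverts C \<and> graph_dist C u v = card (pverts C) div 2"

text \<open>
  The cycle runs through \<open>c\<close>, and \<open>p\<close>, \<open>q\<close> list the vertices of the two attached paths, so that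
  \<open>r = length p\<close> and \<open>s = length q\<close>. The identified end-vertices are \<open>hd p\<close> and \<open>hd q\<close>, which are
  thus vertices of the cycle.
\<close>

definition frog_graph :: "'a pair_pre_digraph \<Rightarrow> bool" where
  "frog_graph G \<longleftrightarrow> (\<exists>c p q.
     distinct c \<and> 3 \<le> length c \<and> distinct p \<and> p \<noteq> [] \<and> distinct q \<and> q \<noteq> [] \<and>
     antipodal (cycle_graph c) (hd p) (hd q) \<and>
     set p \<inter> set c = {hd p} \<and> set q \<inter> set c = {hd q} \<and> set p \<inter> set q = {} \<and>
     pverts G = pverts (cycle_graph c) \<union> pverts (path_graph p) \<union> pverts (path_graph q) \<and>
     parcs G = parcs (cycle_graph c) \<union> parcs (path_graph p) \<union> parcs (path_graph q))"

end

theory Submission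
  imports Defs
begin

text \<open>
  Visibility of \<open>x, y\<close> is certified by one walk avoiding the rest of \<open>X\<close>, provided every
  third \<open>z \<in> X\<close> satisfies \<open>d x z + d z y \<ge> length\<close>: if the walk is not shortest, no shortest
  path can afford to visit \<open>z\<close>. Two kinds of large sets arise in this way: the neighbours of \<open>u\<close>
  together with a vertex \<open>t\<close> for which \<open>u\<close> is a local maximum of \<open>d t\<close>, and two pairs of neighbours
  of vertices \<open>u, v\<close> of degree 3, if the four distances between the pairs are at least \<open>d u v\<close>.

  Let \<open>\<mu>(G) \<le> 3\<close> and let \<open>C\<close> be a shortest cycle; it is isometric. The second kind of set shows
  that vertices off \<open>C\<close> have degree at most 2 and that two branch vertices on \<open>C\<close> are antipodal,
  so there are at most two of them. Maximal paths leaving \<open>C\<close> then exhaust \<open>G\<close>; such a path cannot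
  return to \<open>C\<close>, since otherwise the first kind of set, with \<open>t\<close> halfway around the resulting
  second cycle, has four elements. Hence \<open>G\<close> is a frog.

  Conversely, two points of \<open>X\<close> on the cycle of a frog separate it into two arcs, and all other points
  of \<open>X\<close> lie in the same one; since each tail contains at most one point of \<open>X\<close>, this leaves only the
  case of a point in each tail and two more on the same arc, which antipodality excludes.
  In a tree, the vertices of \<open>X\<close> other than a fixed root \<open>y \<in> X\<close> have disjoint sets of descendants,
  each containing a leaf, and there is a further leaf beyond \<open>y\<close>.
\<close>

section \<open>Distances and visibility\<close>

text \<open>Triangle-freeness makes neighbourhoods rigid: two neighbours of a vertex have distance
  exactly 2, and adjacent vertices share no neighbour. This gives the slack that visibility
  certificates need, so a few distance inequalities replace a description of all shortest paths. The
  obstacle is arithmetic around cycles. Cycles are parametrised periodically by all integers: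
  equality of vertices becomes divisibility by the length, rotation and reflection become
  substitutions in the index, and each claim is proved in one position only. Distances on a cycle
  come from two sources: in the unknown graph from minimality of the cycle, in a frog from a map to
  the integers modulo n that collapses each tail to its attachment vertex. For two branch vertices
  at cycle distance k the condition \<open>2 * k + 2 \<le> n\<close> says that their outer cycle
  neighbours are still at least k apart the other way round. Where it fails, k is n div 2. Upper
  bounds on visible sets come from cuts: if the outer boundary of a vertex set is contained in X, no
  further point of X inside sees one outside.\<close>

locale conn_graph =
  fixes G :: "'a pair_pre_digraph"
  assumes pair_graph: "pair_graph G"
    and connected: "connected (with_proj G)"
    and triangle_free: "triangle_free G"
begin

abbreviation V :: "'a set" where "V \<equiv> pverts G"

abbreviation d :: "'a \<Rightarrow> 'a \<Rightarrow> nat" where "d \<equiv> graph_dist G"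

definition adj :: "'a \<Rightarrow> 'a \<Rightarrow> bool" where "adj x y \<longleftrightarrow> (x, y) \<in> parcs G"

definition nbrs :: "'a \<Rightarrow> 'a set" where "nbrs x = {y. adj x y}"

definition walk :: "'a list \<Rightarrow> bool" where
  "walk p \<longleftrightarrow> p \<noteq> [] \<and> set p \<subseteq> V \<and> successively adj p"

lemma finite_V: "finite V"
  using pair_graph by (simp add: pair_graph_def pair_digraph_def pair_fin_digraph_def pair_fin_digraph_axioms_def)

lemma adj_sym: "adj x y \<Longrightarrow> adj y x"
  using pair_sym_digraph.arcs_symmetric[of G x y] pair_graph
  by (simp add: adj_def pair_graph_def pair_pseudo_graph_def)

lemma adj_irrefl [simp]: "\<not> adj x x"
  using pair_loopfree_digraph.pair_no_loops[of G "(x, x)"] pair_graph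
  by (auto simp: adj_def pair_graph_def pair_digraph_def)

lemma adj_V: "adj x y \<Longrightarrow> x \<in> V" "adj x y \<Longrightarrow> y \<in> V"
proof -
  interpret pair_graph G by (rule pair_graph)
  show "adj x y \<Longrightarrow> x \<in> V" "adj x y \<Longrightarrow> y \<in> V"
    using in_arcsD1 in_arcsD2 by (auto simp: adj_def)
qed

lemma no_triangle: "adj x y \<Longrightarrow> adj y z \<Longrightarrow> adj z x \<Longrightarrow> False"
  using triangle_free unfolding triangle_free_def adj_def by blast

lemma nbrs_iff [simp]: "y \<in> nbrs x \<longleftrightarrow> adj x y"
  by (simp add: nbrs_def)

lemma nbrs_subset: "nbrs x \<subseteq> V"
  by (auto dest: adj_V)

lemma finite_nbrs [simp]: "finite (nbrs x)"
  using nbrs_subset finite_V by (rule finite_subset)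

lemma walk_iff_vwalk: "walk p \<longleftrightarrow> vwalk p (with_proj G)"
proof -
  have "successively adj p \<longleftrightarrow> set (vwalk_arcs p) \<subseteq> parcs G"
    by (induction p rule: vwalk_arcs.induct) (auto simp: adj_def)
  then show ?thesis
    by (auto simp: walk_def vwalk_def)
qed

section \<open>Walks as vertex lists\<close>

lemma walk_single [simp]: "walk [x] \<longleftrightarrow> x \<in> V"
  by (simp add: walk_def)

lemma walk_Cons: "p \<noteq> [] \<Longrightarrow> walk (x # p) \<longleftrightarrow> adj x (hd p) \<and> walk p"
  by (auto simp: walk_def successively_Cons dest: adj_V)

lemma walk_append: "walk p \<Longrightarrow> walk q \<Longrightarrow> adj (last p) (hd q) \<Longrightarrow> walk (p @ q)"
  by (auto simp: walk_def successively_append_iff)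

lemma walk_append_tl:
  assumes "walk p" "walk q" "last p = hd q"
  shows "walk (p @ tl q)"
proof (cases "tl q")
  case (Cons y ys)
  then obtain x where "q = x # y # ys" using assms by (cases q) (auto simp: walk_def)
  then show ?thesis using assms by (auto intro!: walk_append simp: walk_Cons)
qed (use assms in simp)

lemma walk_rev: "walk p \<Longrightarrow> walk (rev p)"
  by (auto simp: walk_def elim!: successively_mono dest: adj_sym)

lemma walk_drop: "walk p \<Longrightarrow> n < length p \<Longrightarrow> walk (drop n p)"
  by (auto simp: walk_def successively_conv_nth dest: in_set_dropD)

lemma walk_take: "walk p \<Longrightarrow> 0 < n \<Longrightarrow> walk (take n p)"
  by (auto simp: walk_def successively_conv_nth dest: in_set_takeD)

lemma walk_nth_adj: "walk p \<Longrightarrow> Suc i < length p \<Longrightarrow> adj (p ! i) (p ! Suc i)"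
  by (auto simp: walk_def successively_conv_nth)

lemma ex_walk:
  assumes "x \<in> V" "y \<in> V"
  shows "\<exists>p. walk p \<and> hd p = x \<and> last p = y"
proof -
  interpret pair_graph G by (rule pair_graph)
  have "symmetric (with_proj G)" using sym_arcs by simp
  moreover have "x \<rightarrow>\<^sup>*\<^bsub>mk_symmetric (with_proj G)\<^esub> y"
    using connected assms unfolding connected_def by (auto simp: strongly_connected_def)
  ultimately have "x \<rightarrow>\<^sup>*\<^bsub>with_proj G\<^esub> y"
    using reachable_mk_symmetric_eq by blast
  then show ?thesis
    using reachable_vwalk_conv walk_iff_vwalk by blast
qed

text \<open>Built from the back: if the new first vertex already occurs in the path found so far,
  the path is cut down to start at that occurrence.\<close>

lemma walk_to_path:
  assumes "walk p"
  shows "\<exists>q. walk q \<and> distinct q \<and> hd q = hd p \<and> last q = last p \<and> set q \<subseteq> set p \<and> length q \<le> length p"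
  using assms
proof (induction p)
  case Nil
  then show ?case by (simp add: walk_def)
next
  case (Cons x p)
  show ?case
  proof (cases "p = []")
    case True
    then show ?thesis using Cons.prems by (intro exI[of _ "[x]"]) auto
  next
    case False
    then have p: "adj x (hd p)" "walk p" using Cons.prems by (auto simp: walk_Cons)
    then obtain q where q: "walk q" "distinct q" "hd q = hd p" "last q = last p"
      "set q \<subseteq> set p" "length q \<le> length p"
      using Cons.IH by blast
    have qne: "q \<noteq> []" using q by (simp add: walk_def)
    show ?thesis
    proof (cases "x \<in> set q")
      case True
      then obtain i where i: "i < length q" "q ! i = x" by (auto simp: in_set_conv_nth)
      show ?thesis
        using i q False by (intro exI[of _ "drop i q"])
          (auto simp: walk_drop hd_drop_conv_nth dest: in_set_dropD)
    next
      case False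
      then show ?thesis using p q qne
        by (intro exI[of _ "x # q"]) (auto simp: walk_Cons)
    qed
  qed
qed

section \<open>Geodesics and the metric\<close>

definition geod :: "'a list \<Rightarrow> 'a \<Rightarrow> 'a \<Rightarrow> bool" where
  "geod p x y \<longleftrightarrow> walk p \<and> hd p = x \<and> last p = y \<and> length p = Suc (d x y)"

text \<open>\<open>graph_dist\<close> minimises over paths only. Passing through
  \<open>walk_to_path\<close> makes arbitrary walks admissible, so later bounds may concatenate
  freely. The \<open>Suc\<close> converts edges to vertices of the list.\<close>

lemma dist_le:
  assumes "walk p"
  shows "Suc (d (hd p) (last p)) \<le> length p"
proof -
  obtain q where q: "walk q" "distinct q" "hd q = hd p" "last q = last p" "length q \<le> length p"
    using walk_to_path[OF assms] by blast
  have "path_between G (hd p) q (last p)"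
    using q by (auto simp: path_between_def vpath_def walk_iff_vwalk)
  then have "d (hd p) (last p) \<le> vwalk_length q"
    unfolding graph_dist_def by (intro Least_le) auto
  moreover have "q \<noteq> []" using q by (simp add: walk_def)
  ultimately show ?thesis using q by (cases q) auto
qed

lemma ex_geod:
  assumes "x \<in> V" "y \<in> V"
  shows "\<exists>p. geod p x y"
proof -
  obtain p where p: "walk p" "hd p = x" "last p = y" using ex_walk assms by blast
  obtain q where q: "walk q" "distinct q" "hd q = hd p" "last q = last p"
    using walk_to_path[OF p(1)] by blast
  have "\<exists>n p. path_between G x p y \<and> vwalk_length p = n"
    using p q by (auto simp: path_between_def vpath_def walk_iff_vwalk)
  then have "\<exists>p. path_between G x p y \<and> vwalk_length p = d x y"
    unfolding graph_dist_def by (rule LeastI_ex)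
  then obtain r where r: "path_between G x r y" "vwalk_length r = d x y" by blast
  moreover have "r \<noteq> []" using r by (auto simp: path_between_def vpath_def vwalk_def)
  ultimately show ?thesis
    by (intro exI[of _ r]) (cases r; auto simp: geod_def path_between_def vpath_def walk_iff_vwalk)
qed

lemma geod_rev: "geod p x y \<Longrightarrow> d x y = d y x \<Longrightarrow> geod (rev p) y x"
  by (auto simp: geod_def walk_rev hd_rev last_rev)

lemma dist_sym:
  assumes "x \<in> V" "y \<in> V"
  shows "d x y = d y x"
proof -
  have "d y x \<le> d x y" if xy: "x \<in> V" "y \<in> V" for x y
  proof -
    obtain p where p: "geod p x y" using ex_geod xy by blast
    then show ?thesis using dist_le[of "rev p"] by (auto simp: geod_def walk_rev hd_rev last_rev)
  qed
  then show ?thesis using assms by (simp add: le_antisym)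
qed

lemma dist_triangle:
  assumes "x \<in> V" "y \<in> V" "z \<in> V"
  shows "d x z \<le> d x y + d y z"
proof -
  obtain p q where p: "geod p x y" and q: "geod q y z" using ex_geod assms by metis
  have pq: "p \<noteq> []" "q \<noteq> []" using p q by (auto simp: geod_def walk_def)
  have "walk (p @ tl q)" using p q by (intro walk_append_tl) (auto simp: geod_def)
  moreover have "last (p @ tl q) = z"
    using p q pq by (cases q) (auto simp: geod_def split: if_splits)
  moreover have "hd (p @ tl q) = x" using p pq by (simp add: geod_def)
  ultimately show ?thesis using dist_le[of "p @ tl q"] p q pq by (auto simp: geod_def)
qed

lemma dist_self [simp]: "x \<in> V \<Longrightarrow> d x x = 0"
  using dist_le[of "[x]"] by simp

lemma dist_eq_0: "x \<in> V \<Longrightarrow> y \<in> V \<Longrightarrow> d x y = 0 \<longleftrightarrow> x = y"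
proof
  assume *: "x \<in> V" "y \<in> V" "d x y = 0"
  then obtain p where p: "geod p x y" using ex_geod by blast
  then have "length p = 1" using * by (simp add: geod_def)
  then obtain z where "p = [z]" by (auto simp: length_Suc_conv)
  then show "x = y" using p by (auto simp: geod_def)
qed auto

lemma dist_pos: "x \<in> V \<Longrightarrow> y \<in> V \<Longrightarrow> x \<noteq> y \<Longrightarrow> 1 \<le> d x y"
  using dist_eq_0[of x y] by auto

lemma dist_adj: "adj x y \<Longrightarrow> d x y = 1"
  using dist_le[of "[x, y]"] dist_pos[of x y] adj_V[of x y] by (fastforce simp: walk_Cons)

lemma dist_1_iff: "x \<in> V \<Longrightarrow> y \<in> V \<Longrightarrow> d x y = 1 \<longleftrightarrow> adj x y"
proof
  assume *: "x \<in> V" "y \<in> V" "d x y = 1"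
  then obtain p where p: "geod p x y" using ex_geod by blast
  then have "length p = Suc (Suc 0)" using * by (simp add: geod_def)
  then obtain u v where "p = [u, v]" by (auto simp: length_Suc_conv)
  then show "adj x y" using p by (auto simp: geod_def walk_Cons)
qed (use dist_adj in auto)

lemma dist_step:
  assumes "adj y z" "x \<in> V"
  shows "d x z \<le> Suc (d x y)" "d x y \<le> Suc (d x z)"
  using dist_triangle[of x y z] dist_triangle[of x z y] assms dist_adj[OF assms(1)] dist_adj[OF adj_sym[OF assms(1)]]
  by (auto dest: adj_V)

text \<open>Distance 1 would close a triangle with \<open>u\<close>.\<close>

lemma dist_2:
  assumes "adj x u" "adj u y" "x \<noteq> y"
  shows "d x y = 2"
proof -
  have "d x y \<le> 2" using dist_step(1)[of u y x] assms dist_adj[OF assms(1)] by (auto dest: adj_V)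
  moreover have "d x y \<noteq> 1" using assms no_triangle[of x u y] dist_1_iff[of x y] by (auto dest: adj_V adj_sym)
  moreover have "d x y \<noteq> 0" using assms dist_eq_0[of x y] by (auto dest: adj_V)
  ultimately show ?thesis by linarith
qed

lemma dist_prev:
  assumes "x \<in> V" "y \<in> V" "x \<noteq> y"
  shows "\<exists>z. adj y z \<and> Suc (d x z) = d x y"
proof -
  obtain p where p: "geod p y x" using ex_geod assms by blast
  have D: "d x y = d y x" using dist_sym assms by blast
  have "1 \<le> d y x" using dist_pos assms by metis
  then obtain z q where q: "p = y # z # q" using p
    by (cases p; cases "tl p") (auto simp: geod_def)
  then have yz: "adj y z" and w: "walk (z # q)" and l: "last (z # q) = x" using p by (auto simp: geod_def walk_Cons)
  have "Suc (d z x) \<le> length (z # q)" using dist_le[OF w] l by simp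
  then have "d z x < d y x" using p q by (auto simp: geod_def)
  moreover have "d z x = d x z" using dist_sym assms adj_V[OF yz] by blast
  ultimately have "d x z < d x y" using D by simp
  then show ?thesis using dist_step[OF yz assms(1)] yz by (intro exI[of _ z]) auto
qed

text \<open>Prefix and suffix of the list bound the two distances from above; by the triangle
  inequality neither bound has any room.\<close>

lemma geod_split:
  assumes "geod p x y" "i < length p"
  shows "d x (p ! i) = i" "d (p ! i) y = d x y - i" "i \<le> d x y"
proof -
  have p: "walk p" "hd p = x" "last p = y" "length p = Suc (d x y)" using assms by (auto simp: geod_def)
  have pne: "p \<noteq> []" using p by (simp add: walk_def)
  have "walk (take (Suc i) p)" using p by (simp add: walk_take)
  moreover have "hd (take (Suc i) p) = x" "last (take (Suc i) p) = p ! i"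
    using p assms pne by (auto simp: take_Suc_conv_app_nth hd_append hd_conv_nth)
  ultimately have 1: "d x (p ! i) \<le> i" using dist_le[of "take (Suc i) p"] assms by auto
  have "walk (drop i p)" using p assms by (simp add: walk_drop)
  moreover have "hd (drop i p) = p ! i" "last (drop i p) = y"
    using p assms by (auto simp: hd_drop_conv_nth)
  ultimately have 2: "Suc (d (p ! i) y) \<le> Suc (d x y) - i" using dist_le[of "drop i p"] p by auto
  have "x \<in> V" "y \<in> V" "p ! i \<in> V"
    using p assms pne by (auto simp: walk_def)
  then have 3: "d x y \<le> d x (p ! i) + d (p ! i) y" using dist_triangle by blast
  show "i \<le> d x y" using assms p by simp
  then show "d x (p ! i) = i" "d (p ! i) y = d x y - i" using 1 2 3 by linarith+
qed

lemma geod_set: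
  assumes "geod p x y" "z \<in> set p"
  shows "d x z + d z y = d x y"
  using geod_split[OF assms(1)] assms(2) by (auto simp: in_set_conv_nth)

lemma geod_distinct: "geod p x y \<Longrightarrow> distinct p"
  unfolding distinct_conv_nth using geod_split(1) by metis

lemma geod_V: "geod p x y \<Longrightarrow> x \<in> V" "geod p x y \<Longrightarrow> y \<in> V"
  by (auto simp: geod_def walk_def)

lemma geod_ends: "geod p x y \<Longrightarrow> x \<in> set p" "geod p x y \<Longrightarrow> y \<in> set p"
  by (auto simp: geod_def walk_def)

lemma shortest_path_iff: "shortest_path G x p y \<longleftrightarrow> geod p x y"
proof
  assume "shortest_path G x p y"
  then show "geod p x y"
    by (cases p) (auto simp: shortest_path_def path_between_def geod_def walk_iff_vwalk vpath_def vwalk_def)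
next
  assume "geod p x y"
  then show "shortest_path G x p y"
    using geod_distinct[of p x y]
    by (auto simp: shortest_path_def path_between_def geod_def walk_iff_vwalk vpath_def)
qed

section \<open>Certificates of mutual visibility\<close>

abbreviation mv :: "'a set \<Rightarrow> bool" where "mv \<equiv> mutual_visibility_set G"

lemma mutually_visible_iff: "mutually_visible G X x y \<longleftrightarrow> (\<exists>p. geod p x y \<and> set p \<inter> X = {x, y})"
  by (simp add: mutually_visible_def shortest_path_iff)

lemma mutually_visible_sym: "mutually_visible G X x y \<Longrightarrow> mutually_visible G X y x"
proof -
  assume "mutually_visible G X x y"
  then obtain p where p: "geod p x y" "set p \<inter> X = {x, y}" by (auto simp: mutually_visible_iff)
  then have "geod (rev p) y x" by (intro geod_rev p dist_sym geod_V[OF p(1)])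
  moreover have "set (rev p) \<inter> X = {y, x}" using p by (simp add: insert_commute)
  ultimately show ?thesis unfolding mutually_visible_iff by blast
qed

lemma mutually_visibleI:
  assumes "walk p" "hd p = x" "last p = y" "x \<in> X" "y \<in> X" "set p \<inter> X \<subseteq> {x, y}"
    and far: "\<And>z. z \<in> X \<Longrightarrow> z \<noteq> x \<Longrightarrow> z \<noteq> y \<Longrightarrow> length p \<le> Suc (d x z + d z y)"
  shows "mutually_visible G X x y"
proof (cases "length p = Suc (d x y)")
  case True
  then have "geod p x y" using assms by (simp add: geod_def)
  then show ?thesis using assms geod_ends[of p x y] by (auto simp: mutually_visible_iff intro!: exI[of _ p])
next
  case False
  then have lt: "Suc (d x y) < length p" using dist_le[of p] assms by simp
  have "x \<in> V" "y \<in> V" using assms by (auto simp: walk_def)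
  then obtain q where q: "geod q x y" using ex_geod by blast
  have "z = x \<or> z = y" if "z \<in> set q" "z \<in> X" for z
    using far[OF that(2)] geod_set[OF q that(1)] lt by linarith
  then have "set q \<inter> X = {x, y}" using geod_ends[OF q] assms by auto
  then show ?thesis using q by (auto simp: mutually_visible_iff)
qed

text \<open>With strict inequalities no geodesic can visit a third point of X, so any geodesic
  serves and no walk has to be exhibited.\<close>

lemma mutually_visible_far:
  assumes "x \<in> V" "y \<in> V" "x \<in> X" "y \<in> X"
    and far: "\<And>z. z \<in> X \<Longrightarrow> z \<noteq> x \<Longrightarrow> z \<noteq> y \<Longrightarrow> d x y < d x z + d z y"
  shows "mutually_visible G X x y"
proof -
  obtain q where q: "geod q x y" using ex_geod assms by blast
  have "z = x \<or> z = y" if "z \<in> set q" "z \<in> X" for z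
    using far[OF that(2)] geod_set[OF q that(1)] by linarith
  then have "set q \<inter> X = {x, y}" using geod_ends[OF q] assms by auto
  then show ?thesis using q by (auto simp: mutually_visible_iff)
qed

text \<open>A function changing by at most 1 along edges bounds distances from below. It is applied
  later to the cyclic distance of positions on a cycle.\<close>

lemma dist_lipschitz:
  fixes f :: "'a \<Rightarrow> int"
  assumes "\<And>u v. adj u v \<Longrightarrow> \<bar>f u - f v\<bar> \<le> 1" "x \<in> V" "y \<in> V"
  shows "\<bar>f x - f y\<bar> \<le> int (d x y)"
  using assms(3)
proof (induction "d x y" arbitrary: y)
  case 0
  then show ?case using dist_eq_0 assms by auto
next
  case (Suc n)
  then have "x \<noteq> y" using assms by auto
  then obtain z where z: "adj y z" "Suc (d x z) = d x y" using dist_prev assms Suc by blast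
  then show ?case using Suc.hyps(1)[of z] Suc.hyps(2) assms(1)[OF z(1)] adj_V[OF z(1)] by auto
qed

lemma card_mv_le: "mv X \<Longrightarrow> card X \<le> mutual_visibility_number G"
proof -
  assume X: "mv X"
  have "{X. mv X} \<subseteq> Pow V" by (auto simp: mutual_visibility_set_def)
  then have "finite {X. mv X}" using finite_V by (meson finite_Pow_iff finite_subset)
  then show ?thesis unfolding mutual_visibility_number_def using X by (intro Max_ge) auto
qed

lemma ex_mv_number: "\<exists>X. mv X \<and> card X = mutual_visibility_number G"
proof -
  have "{X. mv X} \<subseteq> Pow V" by (auto simp: mutual_visibility_set_def)
  then have "finite {X. mv X}" using finite_V by (meson finite_Pow_iff finite_subset)
  moreover have "mv {}" by (simp add: mutual_visibility_set_def)
  ultimately have "mutual_visibility_number G \<in> card ` {X. mv X}"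
    unfolding mutual_visibility_number_def by (intro Max_in) auto
  then show ?thesis by auto
qed

lemma mv_finite: "mv X \<Longrightarrow> finite X"
  using finite_V by (auto simp: mutual_visibility_set_def intro: finite_subset)

lemma mvI:
  assumes "X \<subseteq> V" "\<And>x y. x \<in> X \<Longrightarrow> y \<in> X \<Longrightarrow> x \<noteq> y \<Longrightarrow> mutually_visible G X x y"
  shows "mv X"
  using assms by (auto simp: mutual_visibility_set_def)

lemma mv_geod:
  assumes "mv X" "x \<in> X" "y \<in> X" "x \<noteq> y"
  obtains g where "geod g x y" "set g \<inter> X = {x, y}"
proof -
  have "mutually_visible G X x y" using assms unfolding mutual_visibility_set_def by blast
  then show ?thesis using that unfolding mutually_visible_iff by blast
qed

text \<open>The walk through \<open>u\<close> has three vertices, and a third point of X is at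
  distance at least 1 from both ends, which is exactly the slack required, whatever else X
  contains.\<close>

lemma two_nbrs_visible:
  assumes "adj u x" "adj u y" "x \<noteq> y" "x \<in> X" "y \<in> X" "X \<subseteq> V" "u \<notin> X"
  shows "mutually_visible G X x y"
proof (rule mutually_visibleI[of "[x, u, y]"])
  show "walk [x, u, y]" using assms by (auto simp: walk_Cons adj_sym dest: adj_V)
  fix z assume z: "z \<in> X" "z \<noteq> x" "z \<noteq> y"
  then have "z \<in> V" "x \<in> V" "y \<in> V" using assms by auto
  then show "length [x, u, y] \<le> Suc (d x z + d z y)"
    using dist_pos[of x z] dist_pos[of z y] z by simp
qed (use assms in auto)

lemma mv_nbrs: "mv (nbrs u)"
proof (rule mvI)
  fix x y assume "x \<in> nbrs u" "y \<in> nbrs u" "x \<noteq> y"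
  then show "mutually_visible G (nbrs u) x y"
    by (intro two_nbrs_visible[of u]) (use nbrs_subset in auto)
qed (rule nbrs_subset)

text \<open>A path from \<open>t\<close> to a neighbour \<open>x\<close> of \<open>u\<close> through
  another neighbour \<open>z\<close> has length at least \<open>(d t u - 1) + 2\<close>, since
  \<open>d z x = 2\<close>. This exceeds \<open>d t u\<close>, and \<open>u\<close> being a local
  maximum means \<open>d t x \<le> d t u\<close>.\<close>

lemma mv_nbrs_insert:
  assumes t: "t \<in> V" "t \<noteq> u" "\<not> adj u t" "u \<in> V"
    and max: "\<And>x. adj u x \<Longrightarrow> d t x \<le> d t u"
  shows "mv (insert t (nbrs u))"
proof -
  let ?X = "insert t (nbrs u)"
  have X: "?X \<subseteq> V" using t nbrs_subset by auto
  have tx: "mutually_visible G ?X t x" if x: "adj u x" for x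
  proof (rule mutually_visible_far)
    fix z assume "z \<in> ?X" "z \<noteq> t" "z \<noteq> x"
    then have z: "adj u z" by auto
    have "d z x = 2" using dist_2[of z u x] z x \<open>z \<noteq> x\<close> by (auto dest: adj_sym)
    moreover have "d t u \<le> Suc (d t z)" using dist_step[OF z t(1)] by simp
    ultimately show "d t x < d t z + d z x" using max[OF x] by linarith
  qed (use t x in \<open>auto dest: adj_V\<close>)
  show ?thesis
  proof (rule mvI[OF X])
    fix x y assume "x \<in> ?X" "y \<in> ?X" "x \<noteq> y"
    then consider "x = t" "adj u y" | "y = t" "adj u x" | "adj u x" "adj u y" by auto
    then show "mutually_visible G ?X x y"
    proof cases
      case 3
      then show ?thesis using \<open>x \<noteq> y\<close> X t by (intro two_nbrs_visible[of u]) auto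
    qed (use tx mutually_visible_sym in auto)
  qed
qed

text \<open>The certificate is the walk from \<open>a\<close> along \<open>p\<close> to
  \<open>c\<close>, with \<open>d u v + 3\<close> vertices. A route through \<open>b\<close> costs
  \<open>d a b = 2\<close> plus at least \<open>d u v\<close>, and symmetrically for
  \<open>e\<close>, so the bound of \<open>mutually_visibleI\<close> is met with equality at
  worst.\<close>

lemma branch_visible:
  assumes p: "geod p u v" and "u \<noteq> v"
    and ab: "adj u a" "adj u b" "a \<notin> set p" "b \<notin> set p" "a \<noteq> b"
    and ce: "adj v c" "adj v e" "c \<notin> set p" "e \<notin> set p" "c \<noteq> e"
    and far: "d u v \<le> d a c" "d u v \<le> d a e" "d u v \<le> d b c" "d u v \<le> d b e"
  shows "mutually_visible G {a, b, c, e} a c"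
proof -
  have V: "a \<in> V" "b \<in> V" "c \<in> V" "e \<in> V" "u \<in> V" "v \<in> V" using ab ce by (auto dest: adj_V)
  have uv: "1 \<le> d u v" using dist_pos V assms by auto
  have ne: "a \<noteq> c" "a \<noteq> e" "b \<noteq> c" "b \<noteq> e" using far V uv by force+
  have pne: "p \<noteq> []" using p by (auto simp: geod_def walk_def)
  have db: "d a b = 2" using ab dist_2[of a u b] by (auto dest: adj_sym)
  have de: "d e c = 2" using ce dist_2[of e v c] by (auto dest: adj_sym)
  show ?thesis
  proof (rule mutually_visibleI[of "a # p @ [c]"])
    show "walk (a # p @ [c])"
      using ab(1) adj_sym[OF ab(1)] ce(1) p pne V by (auto simp: walk_Cons geod_def intro!: walk_append)
    show "set (a # p @ [c]) \<inter> {a, b, c, e} \<subseteq> {a, c}" using ab ce ne by auto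
    fix z assume "z \<in> {a, b, c, e}" "z \<noteq> a" "z \<noteq> c"
    then have "z = b \<or> z = e" by auto
    moreover have "length (a # p @ [c]) = d u v + 3" using p by (simp add: geod_def)
    ultimately show "length (a # p @ [c]) \<le> Suc (d a z + d z c)" using db de far by auto
  qed (use pne in auto)
qed

lemma mv_two_branches:
  assumes p: "geod p u v" and uv: "u \<noteq> v"
    and ab: "adj u a" "adj u b" "a \<notin> set p" "b \<notin> set p" "a \<noteq> b"
    and ce: "adj v c" "adj v e" "c \<notin> set p" "e \<notin> set p" "c \<noteq> e"
    and far: "d u v \<le> d a c" "d u v \<le> d a e" "d u v \<le> d b c" "d u v \<le> d b e"
  shows "mv {a, b, c, e} \<and> card {a, b, c, e} = 4"
proof -
  let ?X = "{a, b, c, e}"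
  have V: "a \<in> V" "b \<in> V" "c \<in> V" "e \<in> V" "u \<in> V" "v \<in> V" using ab ce by (auto dest: adj_V)
  have "1 \<le> d u v" using dist_pos V uv by auto
  then have ne: "a \<noteq> c" "a \<noteq> e" "b \<noteq> c" "b \<noteq> e" using far V by force+
  have uX: "u \<notin> ?X" "v \<notin> ?X" using ab ce geod_ends[OF p] by auto
  have X: "?X \<subseteq> V" using V by auto
  \<comment> \<open>These equalities allow \<open>branch_visible\<close> to be reused for the other
    cross pairs by exchanging the names within each pair.\<close>
  have P: "{b, a, c, e} = ?X" "{a, b, e, c} = ?X" "{b, a, e, c} = ?X" by auto
  have ac: "mutually_visible G ?X a c" by (rule branch_visible) fact+
  have ae: "mutually_visible G ?X a e"
    using branch_visible[OF p uv ab ce(2,1,4,3) ce(5)[symmetric] far(2,1,4,3)] P by simp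
  have bc: "mutually_visible G ?X b c"
    using branch_visible[OF p uv ab(2,1,4,3) ab(5)[symmetric] ce far(3,4,1,2)] P by simp
  have be: "mutually_visible G ?X b e"
    using branch_visible[OF p uv ab(2,1,4,3) ab(5)[symmetric] ce(2,1,4,3) ce(5)[symmetric] far(4,3,2,1)] P by simp
  have ab': "mutually_visible G ?X a b" by (rule two_nbrs_visible[of u]) (use ab X uX in auto)
  have ce': "mutually_visible G ?X c e" by (rule two_nbrs_visible[of v]) (use ce X uX in auto)
  note vis = ab' ce' ac ae bc be
  have "mv ?X"
  proof (rule mvI[OF X])
    fix x y assume "x \<in> ?X" "y \<in> ?X" "x \<noteq> y"
    then show "mutually_visible G ?X x y"
      using vis vis[THEN mutually_visible_sym] by (elim insertE emptyE) simp_all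
  qed
  then show ?thesis using ne ab ce by auto
qed

end

section \<open>Cycles\<close>

text \<open>Reading the list modulo its length at every integer removes the special role of the
  closing edge.\<close>

definition cyc_fun :: "'a list \<Rightarrow> int \<Rightarrow> 'a" where
  "cyc_fun xs i = xs ! nat (i mod int (length xs))"

lemma cyc_fun_nth: "i < length xs \<Longrightarrow> cyc_fun xs (int i) = xs ! i"
  by (simp add: cyc_fun_def)

lemma cyc_fun_eq_iff:
  assumes "distinct xs" "xs \<noteq> []"
  shows "cyc_fun xs i = cyc_fun xs j \<longleftrightarrow> int (length xs) dvd i - j"
proof -
  have np: "0 < int (length xs)" using assms by simp
  have "cyc_fun xs i = cyc_fun xs j \<longleftrightarrow> nat (i mod int (length xs)) = nat (j mod int (length xs))"
    using pos_mod_bound[OF np] pos_mod_sign[OF np] unfolding cyc_fun_def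
    by (intro nth_eq_iff_index_eq assms) (auto simp: nat_less_iff)
  also have "\<dots> \<longleftrightarrow> i mod int (length xs) = j mod int (length xs)"
    using pos_mod_sign[OF np] by (simp add: eq_nat_nat_iff)
  finally show ?thesis by (simp add: mod_eq_dvd_iff)
qed

lemma cyc_fun_mod: "cyc_fun xs (i mod int (length xs)) = cyc_fun xs i"
  by (simp add: cyc_fun_def)

lemma range_cyc_fun: "xs \<noteq> [] \<Longrightarrow> range (cyc_fun xs) = set xs"
proof (intro equalityI subsetI)
  assume ne: "xs \<noteq> []"
  fix x assume "x \<in> range (cyc_fun xs)"
  then obtain i where "x = xs ! nat (i mod int (length xs))" by (auto simp: cyc_fun_def)
  moreover have "nat (i mod int (length xs)) < length xs" using ne by (simp add: nat_less_iff)
  ultimately show "x \<in> set xs" by simp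
next
  fix x assume "x \<in> set xs"
  then obtain i where "i < length xs" "x = xs ! i" by (auto simp: in_set_conv_nth)
  then show "x \<in> range (cyc_fun xs)" using cyc_fun_nth[of i xs] by (metis rangeI)
qed

text \<open>The distance between residues 0 and \<open>k\<close> in a cycle of length
  \<open>n\<close>: the smaller of the step counts in the two directions.\<close>

definition cyc_dist :: "nat \<Rightarrow> int \<Rightarrow> int" where
  "cyc_dist n k = min (k mod int n) ((- k) mod int n)"

lemma cyc_dist_minus [simp]: "cyc_dist n (- k) = cyc_dist n k"
  by (simp add: cyc_dist_def min.commute)

lemma cyc_dist_commute: "cyc_dist n (i - j) = cyc_dist n (j - i)"
  using cyc_dist_minus[of n "i - j"] by simp

lemma cyc_dist_mod: "cyc_dist n (k mod int n) = cyc_dist n k"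
  by (simp add: cyc_dist_def mod_minus_eq)

lemma cyc_dist_cong: "k mod int n = l mod int n \<Longrightarrow> cyc_dist n k = cyc_dist n l"
  by (metis cyc_dist_mod)

lemma cyc_dist_eq: "0 < n \<Longrightarrow> 0 \<le> k \<Longrightarrow> k \<le> int n \<Longrightarrow> cyc_dist n k = min k (int n - k)"
  by (cases "k = 0 \<or> k = int n") (auto simp: cyc_dist_def zmod_zminus1_eq_if)

lemma cyc_dist_mod_eq: "0 < n \<Longrightarrow> cyc_dist n k = min (k mod int n) (int n - k mod int n)"
  using cyc_dist_eq[of n "k mod int n"] cyc_dist_mod by (simp add: less_imp_le)

lemma cyc_dist_nonneg: "0 < n \<Longrightarrow> 0 \<le> cyc_dist n k"
  by (simp add: cyc_dist_def)

lemma cyc_dist_half: "0 < n \<Longrightarrow> 2 * cyc_dist n k \<le> int n"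
  by (auto simp: cyc_dist_mod_eq min_def)

lemma cyc_dist_0_iff: "0 < n \<Longrightarrow> cyc_dist n k = 0 \<longleftrightarrow> int n dvd k"
proof -
  assume n: "0 < n"
  then have "k mod int n < int n" "0 \<le> k mod int n" by simp_all
  then show ?thesis using n unfolding cyc_dist_mod_eq[OF n] dvd_eq_mod_eq_0 by linarith
qed

lemma cyc_dist_succ:
  assumes "0 < n"
  shows "\<bar>cyc_dist n (k + 1) - cyc_dist n k\<bar> \<le> 1"
proof -
  define m where "m = k mod int n"
  have m: "0 \<le> m" "m < int n" using assms by (auto simp: m_def)
  have "cyc_dist n (k + 1) = cyc_dist n (m + 1)"
    by (rule cyc_dist_cong) (simp add: m_def mod_add_left_eq)
  moreover have "cyc_dist n k = cyc_dist n m"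
    by (rule cyc_dist_cong) (simp add: m_def)
  ultimately show ?thesis using m assms by (simp add: cyc_dist_eq)
qed

lemma cyc_dist_1_iff:
  assumes "3 \<le> n"
  shows "cyc_dist n k = 1 \<longleftrightarrow> int n dvd k - 1 \<or> int n dvd k + 1"
proof -
  define m where "m = k mod int n"
  have m: "0 \<le> m" "m < int n" using assms by (auto simp: m_def)
  have "int n dvd k - 1 \<longleftrightarrow> int n dvd m - 1" "int n dvd k + 1 \<longleftrightarrow> int n dvd m + 1"
    by (simp_all add: m_def dvd_eq_mod_eq_0 mod_diff_left_eq mod_add_left_eq)
  moreover have "int n dvd m - 1 \<longleftrightarrow> m = 1"
    using m assms zdvd_not_zless[of "m - 1" "int n"] by (cases "m = 0") (auto dest: zdvd_imp_le)
  moreover have "int n dvd m + 1 \<longleftrightarrow> m = int n - 1"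
    using m assms by (auto dest: zdvd_imp_le)
  moreover have "cyc_dist n k = min m (int n - m)" using assms by (simp add: cyc_dist_mod_eq m_def)
  ultimately show ?thesis using m assms by auto
qed

section \<open>Cycles as periodic integer-indexed maps\<close>

context conn_graph
begin

text \<open>A cycle subgraph of length \<open>n\<close>; chords are permitted here and are excluded
  only for shortest cycles.\<close>

definition cyc :: "nat \<Rightarrow> (int \<Rightarrow> 'a) \<Rightarrow> bool" where
  "cyc n c \<longleftrightarrow> 3 \<le> n \<and> (\<forall>i. adj (c i) (c (i + 1))) \<and> (\<forall>i j. c i = c j \<longleftrightarrow> int n dvd i - j)"

lemma cyc_adj: "cyc n c \<Longrightarrow> adj (c i) (c (i + 1))" "cyc n c \<Longrightarrow> adj (c i) (c (i - 1))"
proof -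
  assume c: "cyc n c"
  then show "adj (c i) (c (i + 1))" by (auto simp: cyc_def)
  from c have "adj (c (i - 1)) (c (i - 1 + 1))" unfolding cyc_def by blast
  then show "adj (c i) (c (i - 1))" using adj_sym by simp
qed

lemma cyc_V: "cyc n c \<Longrightarrow> c i \<in> V"
  using cyc_adj adj_V by blast

lemma cyc_eq_iff: "cyc n c \<Longrightarrow> c i = c j \<longleftrightarrow> int n dvd i - j"
  by (simp add: cyc_def)

lemma cyc_shift: "cyc n c \<Longrightarrow> cyc n (\<lambda>i. c (s + i))"
  by (auto simp: cyc_def add.assoc[symmetric])

lemma cyc_rev: "cyc n c \<Longrightarrow> cyc n (\<lambda>i. c (s - i))"
proof -
  assume c: "cyc n c"
  have "adj (c (s - i)) (c (s - (i + 1)))" for i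
    using cyc_adj(2)[OF c, of "s - i"] by (simp add: algebra_simps)
  moreover have "c (s - i) = c (s - j) \<longleftrightarrow> int n dvd i - j" for i j
    using c by (simp add: cyc_eq_iff dvd_diff_commute)
  ultimately show ?thesis using c by (auto simp: cyc_def)
qed

lemma cyc_neq: "cyc n c \<Longrightarrow> 0 < \<bar>i - j\<bar> \<Longrightarrow> \<bar>i - j\<bar> < int n \<Longrightarrow> c i \<noteq> c j"
  using zdvd_not_zless[of "\<bar>i - j\<bar>" "int n"] by (auto simp: cyc_eq_iff)

lemma list_cyc:
  assumes "distinct xs" "3 \<le> length xs" "successively adj xs" "adj (last xs) (hd xs)"
  shows "cyc (length xs) (cyc_fun xs)"
proof -
  let ?n = "int (length xs)"
  have n: "3 \<le> ?n" using assms by simp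
  then have np: "0 < ?n" by linarith
  have ne: "xs \<noteq> []" using assms by auto
  have "adj (cyc_fun xs i) (cyc_fun xs (i + 1))" for i
  proof -
    define m where "m = i mod ?n"
    have m: "0 \<le> m" "m < ?n" by (simp_all only: m_def pos_mod_sign[OF np] pos_mod_bound[OF np])
    have *: "(i + 1) mod ?n = (m + 1) mod ?n" by (simp add: m_def mod_add_left_eq)
    show ?thesis
    proof (cases "m + 1 = ?n")
      case True
      then have "nat m = length xs - 1" by simp
      then have "xs ! nat m = last xs" using ne by (simp add: last_conv_nth)
      moreover have "xs ! nat ((i + 1) mod ?n) = hd xs" using True * ne by (simp add: hd_conv_nth)
      ultimately show ?thesis using assms by (simp add: cyc_fun_def m_def)
    next
      case False
      then have "(i + 1) mod ?n = m + 1" using * m by simp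
      then show ?thesis using successively_nth[OF assms(3), of "nat m"] m False
        by (simp add: cyc_fun_def m_def nat_add_distrib)
    qed
  qed
  then show ?thesis using assms cyc_fun_eq_iff[OF assms(1) ne] by (simp add: cyc_def)
qed

text \<open>Once shortened to a path, the walk still has two distinct ends, so together with
  \<open>v\<close> it closes to a cycle. The bound on its length is what contradicts minimality of a
  shortest cycle later.\<close>

lemma cyc_if_detour:
  assumes "adj v w" "adj v w'" "w \<noteq> w'" "walk p" "hd p = w" "last p = w'" "v \<notin> set p"
  shows "\<exists>m c. cyc m c \<and> m \<le> Suc (length p)"
proof -
  obtain q where q: "walk q" "distinct q" "hd q = w" "last q = w'" "set q \<subseteq> set p" "length q \<le> length p"
    using walk_to_path[OF assms(4)] assms by auto
  have "q \<noteq> []" using q by (simp add: walk_def)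
  moreover from this have "tl q \<noteq> []" using q assms by (cases q) auto
  ultimately have "2 \<le> length q" by (cases q; cases "tl q") auto
  then have "cyc (length (v # q)) (cyc_fun (v # q))"
    using q assms \<open>q \<noteq> []\<close> adj_sym by (intro list_cyc) (auto simp: successively_Cons walk_def)
  moreover have "length (v # q) \<le> Suc (length p)" using q by simp
  ultimately show ?thesis by blast
qed

lemma cyc_arc_walk:
  assumes "cyc n c"
  shows "walk (map (\<lambda>i. c (s + int i)) [0..<Suc k])"
    "hd (map (\<lambda>i. c (s + int i)) [0..<Suc k]) = c s"
    "last (map (\<lambda>i. c (s + int i)) [0..<Suc k]) = c (s + int k)"
proof -
  have "c (s + int (i + 1)) = c (s + int i + 1)" for i by (simp add: algebra_simps)
  then have "adj (c (s + int i)) (c (s + int (Suc i)))" for i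
    using cyc_adj(1)[OF assms, of "s + int i"] by simp
  then have "successively adj (map (\<lambda>i. c (s + int i)) [0..<Suc k])"
    by (auto simp: successively_conv_nth simp del: upt_Suc)
  then show "walk (map (\<lambda>i. c (s + int i)) [0..<Suc k])"
    using cyc_V[OF assms] by (auto simp: walk_def)
  show "hd (map (\<lambda>i. c (s + int i)) [0..<Suc k]) = c s"
    by (simp add: hd_map del: upt_Suc)
  show "last (map (\<lambda>i. c (s + int i)) [0..<Suc k]) = c (s + int k)"
    by (simp add: last_map)
qed

lemma cyc_walk_dist: "cyc n c \<Longrightarrow> d (c s) (c (s + int k)) \<le> k"
  using dist_le[OF cyc_arc_walk(1)[of n c s k]] cyc_arc_walk(2,3)[of n c s k] by simp

section \<open>Shortest cycles are isometric\<close>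

definition shortest_cyc :: "nat \<Rightarrow> (int \<Rightarrow> 'a) \<Rightarrow> bool" where
  "shortest_cyc n c \<longleftrightarrow> cyc n c \<and> (\<forall>m c'. cyc m c' \<longrightarrow> n \<le> m)"

lemma shortest_cyc_cyc: "shortest_cyc n c \<Longrightarrow> cyc n c"
  by (simp add: shortest_cyc_def)

lemma shortest_cyc_shift: "shortest_cyc n c \<Longrightarrow> shortest_cyc n (\<lambda>i. c (s + i))"
  by (auto simp: shortest_cyc_def cyc_shift)

lemma shortest_cyc_rev: "shortest_cyc n c \<Longrightarrow> shortest_cyc n (\<lambda>i. c (s - i))"
  by (auto simp: shortest_cyc_def cyc_rev)

lemma shortest_cyc_detour:
  assumes "shortest_cyc n c" "adj v w" "adj v w'" "w \<noteq> w'" "walk p" "hd p = w" "last p = w'" "v \<notin> set p"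
  shows "n \<le> Suc (length p)"
  using cyc_if_detour[OF assms(2-)] assms(1) by (fastforce simp: shortest_cyc_def)

lemma ex_shortest_cyc: "cyc m c' \<Longrightarrow> \<exists>n c. shortest_cyc n c"
  using exists_least_iff[of "\<lambda>n. \<exists>c. cyc n c"] unfolding shortest_cyc_def by (metis not_le)

text \<open>Suppose \<open>k + 1\<close> steps along the cycle could be shortened. The last vertex
  has a neighbour \<open>y\<close> closer to \<open>c s\<close>, different from
  \<open>c (s + int k)\<close>, whose distance is exactly \<open>k\<close> by induction. Going from
  \<open>y\<close> to \<open>c s\<close> by a geodesic and on along the arc joins two neighbours of
  the last vertex, giving a cycle of length at most \<open>2 * k + 1 < n\<close>.\<close>

lemma shortest_cyc_half:
  assumes sc: "shortest_cyc n c"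
  shows "2 * k \<le> n \<Longrightarrow> d (c s) (c (s + int k)) = k"
proof (induction k)
  case 0
  then show ?case using cyc_V shortest_cyc_cyc[OF sc] by simp
next
  case (Suc k)
  note c = shortest_cyc_cyc[OF sc]
  let ?x = "c (s + int (Suc k))"
  have IH: "d (c s) (c (s + int k)) = k" using Suc by simp
  have xV: "?x \<in> V" "c s \<in> V" using cyc_V[OF c] by auto
  have ne: "c s \<noteq> ?x" using Suc.prems by (intro cyc_neq[OF c]) auto
  show ?case
  proof (rule ccontr)
    assume "\<not> ?case"
    then have e: "d (c s) ?x \<le> k" using cyc_walk_dist[OF c, of s "Suc k"] by simp
    obtain y where y: "adj ?x y" "Suc (d (c s) y) = d (c s) ?x"
      using dist_prev[OF xV(2,1) ne] by blast
    have yV: "y \<in> V" using y adj_V by blast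
    obtain q where q: "geod q y (c s)" using ex_geod yV xV by blast
    have q': "walk q" "hd q = y" "last q = c s" "length q = Suc (d (c s) y)" "q \<noteq> []"
      using q dist_sym[OF yV xV(2)] by (auto simp: geod_def walk_def)
    have xq: "?x \<notin> set q"
    proof
      assume "?x \<in> set q"
      then have "d y ?x + d ?x (c s) = d y (c s)" using geod_set q by blast
      then show False using y dist_sym[OF yV xV(2)] dist_sym[OF xV] by simp
    qed
    let ?r = "map (\<lambda>i. c (s + int i)) [0..<Suc k]"
    have r: "walk ?r" "hd ?r = c s" "last ?r = c (s + int k)" "length ?r = Suc k"
      using cyc_arc_walk[OF c] by auto
    have xr: "?x \<notin> set ?r"
    proof
      assume "?x \<in> set ?r"
      then obtain i where "i < Suc k" "?x = c (s + int i)" by (auto simp del: of_nat_Suc upt_Suc)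
      then show False using cyc_neq[OF c, of "s + int (Suc k)" "s + int i"] Suc.prems by simp
    qed
    have "n \<le> Suc (length (q @ tl ?r))"
    proof (rule shortest_cyc_detour[OF sc y(1)])
      show "adj ?x (c (s + int k))" using cyc_adj(2)[OF c, of "s + int (Suc k)"] by (simp add: algebra_simps)
      show "y \<noteq> c (s + int k)" using y e IH by auto
      show "walk (q @ tl ?r)" using q' r by (intro walk_append_tl) auto
      show "hd (q @ tl ?r) = y" using q' by simp
      show "last (q @ tl ?r) = c (s + int k)"
      proof (cases "k = 0")
        case True
        then show ?thesis using q' by simp
      next
        case False
        then have "tl ?r \<noteq> []" by (simp flip: length_greater_0_conv)
        then show ?thesis using r(3) by (simp add: last_tl del: upt_Suc)
      qed
      show "?x \<notin> set (q @ tl ?r)" using xq xr list.set_sel(2)[of ?r] by (auto simp del: upt_Suc)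
    qed
    then show False using q' r y e Suc.prems by simp
  qed
qed

text \<open>One of the two directions from \<open>c j\<close> to \<open>c i\<close> covers at most
  half of the cycle; \<open>shortest_cyc_half\<close> is applied to that one.\<close>

lemma shortest_cyc_dist:
  assumes sc: "shortest_cyc n c"
  shows "int (d (c i) (c j)) = cyc_dist n (i - j)"
proof -
  note c = shortest_cyc_cyc[OF sc]
  have n: "3 \<le> n" using c by (simp add: cyc_def)
  define m where "m = (i - j) mod int n"
  have m: "0 \<le> m" "m < int n" using n by (auto simp: m_def)
  have ci: "c i = c (j + m)"
    unfolding cyc_eq_iff[OF c] m_def by (metis add_diff_cancel_left' diff_diff_eq dvd_minus_mod)
  have D: "cyc_dist n (i - j) = min m (int n - m)" using n by (simp add: cyc_dist_mod_eq m_def)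
  have V: "c i \<in> V" "c j \<in> V" using cyc_V[OF c] by auto
  show ?thesis
  proof (cases "2 * m \<le> int n")
    case True
    then have "d (c j) (c (j + int (nat m))) = nat m" using m by (intro shortest_cyc_half[OF sc]) auto
    then show ?thesis using ci D m True dist_sym[OF V] by simp
  next
    case False
    have "c (j + m + int (nat (int n - m))) = c j" using cyc_eq_iff[OF c] m by simp
    moreover have "d (c (j + m)) (c (j + m + int (nat (int n - m)))) = nat (int n - m)"
      using m False by (intro shortest_cyc_half[OF sc]) auto
    ultimately show ?thesis using ci D m False by simp
  qed
qed

text \<open>The heads of the arcs of a closed walk form a distinct cyclic vertex list; conversely
  one period of \<open>c\<close> is read off as an arc list. The length bound 3 excludes running
  back and forth on one edge.\<close>

lemma undirected_tree_iff: "undirected_tree G \<longleftrightarrow> \<not> (\<exists>n c. cyc n c)"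
proof -
  interpret pg: Pair_Digraph.pair_graph G by (rule pair_graph)
  have "\<exists>n c. cyc n c" if p: "pre_digraph.cycle (with_proj G) p" "3 \<le> length p" for p
  proof -
    obtain u where u: "pg.awalk u p u" "distinct (tl (pawalk_verts u p))"
      using p unfolding pg.cycle_def by blast
    have ne: "p \<noteq> []" using p by auto
    have V: "pawalk_verts u p = fst (hd p) # map snd p"
      using pg.awalk_verts_conv'[of u p u] u ne by (simp add: pg.awalk_def)
    have P: "set p \<subseteq> parcs G" using u by (simp add: pg.awalk_def)
    have C: "pcas u p u" using u by (simp add: pg.awalk_def)
    have S: "successively (\<lambda>x y. snd x = fst y) p \<and> (p \<noteq> [] \<longrightarrow> snd (last p) = v \<and> fst (hd p) = u)" if "pcas u p v" for u v
      using that by (induction p arbitrary: u) (auto simp: successively_Cons neq_Nil_conv)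
    have "successively adj (map snd p)"
      unfolding successively_map
    proof (rule successively_mono[OF conjunct1[OF S[OF C]]])
      fix x y assume "x \<in> set p" "y \<in> set p" "snd x = fst y"
      then show "adj (snd x) (snd y)" using P by (cases y) (auto simp: adj_def)
    qed
    moreover have "adj (last (map snd p)) (hd (map snd p))"
    proof -
      have "last (map snd p) = u" "fst (hd p) = u" using S[OF C] ne by (auto simp: last_map)
      moreover have "hd p \<in> parcs G" using P ne by auto
      ultimately show ?thesis using ne by (cases "hd p") (auto simp: adj_def hd_map)
    qed
    ultimately show ?thesis
      using list_cyc[of "map snd p"] u V p by auto
  qed
  moreover have "\<exists>p. pre_digraph.cycle (with_proj G) p \<and> 3 \<le> length p" if c: "cyc n c" for n c
  proof -
    let ?p = "\<lambda>s k. map (\<lambda>i. (c (s + int i), c (s + int i + 1))) [0..<k]"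
    have cas: "pcas (c s) (?p s k) (c (s + int k))" for s k
    proof (induction k arbitrary: s)
      case (Suc k)
      have "?p s (Suc k) = (c s, c (s + 1)) # ?p (s + 1) k"
        by (simp add: upt_conv_Cons flip: map_Suc_upt del: upt_Suc) (simp add: algebra_simps)
      then show ?case using Suc[of "s + 1"] by (simp add: algebra_simps)
    qed simp
    have n: "3 \<le> n" using c by (simp add: cyc_def)
    have cn: "c (int n) = c 0" using c by (simp add: cyc_eq_iff)
    have aw: "pg.awalk (c 0) (?p 0 n) (c 0)"
      using cas[of 0 n] cyc_V[OF c] cyc_adj(1)[OF c] by (auto simp: pg.awalk_def adj_def cn)
    have "distinct (map snd (?p 0 n))"
      unfolding distinct_conv_nth using cyc_neq[OF c] by auto
    then have "distinct (tl (pawalk_verts (c 0) (?p 0 n)))"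
      using pg.awalk_verts_conv'[of "c 0" "?p 0 n" "c 0"] aw n by (simp add: pg.awalk_def)
    then have "pre_digraph.cycle (with_proj G) (?p 0 n)"
      using aw n unfolding pg.cycle_def by auto
    then show ?thesis using n by (intro exI[of _ "?p 0 n"]) simp
  qed
  ultimately show ?thesis using connected unfolding undirected_tree_def by blast
qed

end

section \<open>Graphs with small mutual-visibility number\<close>

text \<open>Recovers a displacement from its length up to sign. This is how antipodality is turned
  back into indices.\<close>

lemma cyc_dist_cases:
  assumes "0 < n"
  shows "int n dvd k - cyc_dist n k \<or> int n dvd k + cyc_dist n k"
proof -
  have "int n dvd k - k mod int n" by (rule dvd_minus_mod)
  moreover from this have "int n dvd k - k mod int n + int n" by (intro dvd_add) auto
  ultimately show ?thesis unfolding cyc_dist_mod_eq[OF assms] min_def by (auto simp: algebra_simps)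
qed

context conn_graph
begin

text \<open>A neighbour of the start that lies on the geodesic must be its entry at index 1. Hence a
  vertex with three neighbours has two off any geodesic that starts there.\<close>

lemma geod_unique_nbr:
  assumes "geod p w x" "z \<in> set p" "z' \<in> set p" "adj w z" "adj w z'"
  shows "z = z'"
proof -
  obtain i j where "i < length p" "p ! i = z" "j < length p" "p ! j = z'"
    using assms by (auto simp: in_set_conv_nth)
  then show ?thesis using geod_split(1)[OF assms(1)] dist_adj[OF assms(4)] dist_adj[OF assms(5)] by metis
qed

lemma chain_dist:
  assumes "s \<le> t" "w s \<in> V" "\<And>r. s \<le> r \<Longrightarrow> r < t \<Longrightarrow> adj (w r) (w (Suc r))"
  shows "d (w s) (w t) \<le> t - s"
  using assms(1,3)
proof (induction t rule: dec_induct)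
  case base
  then show ?case using assms by simp
next
  case (step t)
  then have "d (w s) (w (Suc t)) \<le> Suc (d (w s) (w t))" using dist_step assms(2) by simp
  then show ?case using step by fastforce
qed

lemma cyc_ge_4: "cyc n c \<Longrightarrow> 4 \<le> n"
proof (rule ccontr)
  assume c: "cyc n c" and "\<not> 4 \<le> n"
  then have "n = 3" by (auto simp: cyc_def)
  then have "c 3 = c 0" using cyc_eq_iff[OF c] by simp
  then have "adj (c 0) (c 1)" "adj (c 1) (c 2)" "adj (c 2) (c 0)"
    using cyc_adj(1)[OF c, of 0] cyc_adj(1)[OF c, of 1] cyc_adj(1)[OF c, of 2] by simp_all
  then show False by (rule no_triangle)
qed

lemma shortest_cyc_chordless:
  assumes "shortest_cyc n c" "adj (c i) (c j)"
  shows "c j = c (i + 1) \<or> c j = c (i - 1)"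
proof -
  have c: "cyc n c" using assms shortest_cyc_cyc by blast
  have "cyc_dist n (j - i) = 1"
    using shortest_cyc_dist[OF assms(1), of i j] dist_adj[OF assms(2)] by (simp add: cyc_dist_commute)
  then have "int n dvd j - i - 1 \<or> int n dvd j - i + 1" using c by (simp add: cyc_dist_1_iff cyc_def)
  then show ?thesis by (simp add: cyc_eq_iff[OF c] algebra_simps)
qed

lemma cyc_nbrs_distinct: "cyc n c \<Longrightarrow> c (i + 1) \<noteq> c (i - 1)"
  using cyc_ge_4[of n c] by (intro cyc_neq) auto

end

section \<open>Branch vertices when no visible set has four elements\<close>

locale small_mv_graph = conn_graph +
  assumes mv_card: "mv X \<Longrightarrow> card X \<le> 3"
begin

lemma four_nbrs:
  assumes "adj u a" "adj u b" "adj u e" "adj u f" "a \<noteq> b" "a \<noteq> e" "a \<noteq> f" "b \<noteq> e" "b \<noteq> f" "e \<noteq> f"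
  shows False
proof -
  have "card {a, b, e, f} \<le> card (nbrs u)" using assms by (intro card_mono) auto
  then show False using mv_card[OF mv_nbrs, of u] assms by simp
qed

text \<open>With \<open>d u v = 1\<close> the four distance conditions of
  \<open>mv_two_branches\<close> only say that neighbours of \<open>u\<close> and of
  \<open>v\<close> are different, which is triangle-freeness.\<close>

lemma adjacent_branches:
  assumes "adj u v" "adj u a" "adj u b" "adj v e" "adj v f"
    "a \<noteq> b" "a \<noteq> v" "b \<noteq> v" "e \<noteq> f" "e \<noteq> u" "f \<noteq> u"
  shows False
proof -
  have uv: "d u v = 1" using assms dist_adj by blast
  have p: "geod [u, v] u v" using assms uv adj_V[OF assms(1)] by (simp add: geod_def walk_Cons)
  have far: "d u v \<le> d x y" if "adj u x" "adj v y" for x y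
  proof -
    have "x \<noteq> y" using that assms(1) no_triangle[of u v y] adj_sym by blast
    then show ?thesis using dist_pos[of x y] that uv adj_V by force
  qed
  have neq: "u \<noteq> v" "u \<noteq> a" "u \<noteq> b" "v \<noteq> e" "v \<noteq> f" using assms adj_irrefl by metis+
  have "mv {a, b, e, f} \<and> card {a, b, e, f} = 4"
    by (rule mv_two_branches[OF p]) (use assms neq far in auto)
  then show False using mv_card by force
qed

context
  fixes n :: nat and c :: "int \<Rightarrow> 'a"
  assumes sc: "shortest_cyc n c"
begin

lemma cyc_c: "cyc n c" using sc by (rule shortest_cyc_cyc)

lemma n_ge_4: "4 \<le> n" using cyc_ge_4[OF cyc_c] .

lemma branch_unique:
  assumes "adj (c i) a" "adj (c i) b" "a \<notin> range c" "b \<notin> range c"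
  shows "a = b"
  using four_nbrs[of "c i" "c (i + 1)" "c (i - 1)" a b] cyc_adj[OF cyc_c, of i] cyc_nbrs_distinct[OF cyc_c, of i] assms
  by (metis rangeI)

lemma branch_nbrs:
  assumes "adj (c i) a" "a \<notin> range c"
  shows "nbrs (c i) = {c (i + 1), c (i - 1), a}"
proof (intro equalityI subsetI)
  fix x assume "x \<in> nbrs (c i)"
  then show "x \<in> {c (i + 1), c (i - 1), a}"
    using branch_unique[OF assms(1), of x] assms shortest_cyc_chordless[OF sc, of i] by (cases "x \<in> range c") auto
qed (use assms cyc_adj[OF cyc_c, of i] in auto)

lemma no_adjacent_branches:
  assumes "adj (c i) (c j)" "adj (c i) a" "adj (c j) b" "a \<notin> range c" "b \<notin> range c"
  shows False
proof -
  have main: False if "adj (c i) a" "adj (c (i + 1)) b" "a \<notin> range c" "b \<notin> range c" for i a b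
  proof (rule adjacent_branches[of "c i" "c (i + 1)" "c (i - 1)" a "c (i + 2)" b])
    show "adj (c i) (c (i + 1))" "adj (c i) (c (i - 1))" using cyc_adj[OF cyc_c] by auto
    show "adj (c (i + 1)) (c (i + 2))" using cyc_adj(1)[OF cyc_c, of "i + 1"] by (simp add: add.commute)
    show "c (i - 1) \<noteq> c (i + 1)" "c (i + 2) \<noteq> c i" using n_ge_4 cyc_neq[OF cyc_c, of "i - 1" "i + 1"] cyc_neq[OF cyc_c, of "i + 2" i] by auto
  qed (use that in auto)
  have "c j = c (i + 1) \<or> c j = c (i - 1)" using shortest_cyc_chordless[OF sc] assms(1) .
  then show False
  proof
    assume "c j = c (i + 1)"
    then show False using main[of i a b] assms by simp
  next
    assume "c j = c (i - 1)"
    then show False using main[of "i - 1" b a] assms by simp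
  qed
qed

text \<open>The two branch pairs are two neighbours of \<open>w\<close> off a geodesic to a nearest
  cycle vertex \<open>c i\<close>, and the cycle neighbours of \<open>c i\<close>. If some neighbour
  \<open>x\<close> of \<open>w\<close> were too close to a cycle neighbour \<open>c s\<close>, then
  \<open>c s\<close> would also be nearest to \<open>w\<close> and be reached from off the cycle. So
  \<open>c i\<close> and \<open>c s\<close> would be adjacent branch vertices, which is
  impossible.\<close>

lemma off_cyc_degree:
  assumes "w \<notin> range c" "adj w x1" "adj w x2" "adj w x3" "x1 \<noteq> x2" "x1 \<noteq> x3" "x2 \<noteq> x3"
  shows False
proof -
  have wV: "w \<in> V" using assms adj_V by blast
  obtain i where i: "\<And>j. d w (c i) \<le> d w (c j)"
    using ex_has_least_nat[of "\<lambda>_. True" 0 "\<lambda>i. d w (c i)"] by auto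
  define k where "k = d w (c i)"
  have cV: "c j \<in> V" for j using cyc_V[OF cyc_c] .
  have k: "1 \<le> k" unfolding k_def using assms(1) wV cV by (intro dist_pos) auto
  obtain p where p: "geod p w (c i)" using ex_geod wV cV by blast
  obtain a b where ab: "adj w a" "adj w b" "a \<noteq> b" "a \<notin> set p" "b \<notin> set p"
    using geod_unique_nbr[OF p] assms(2-) by metis
  obtain y0 where y0: "adj (c i) y0" "Suc (d w y0) = k"
    using dist_prev[OF wV cV, of i] assms(1) unfolding k_def by blast
  have y0_off: "y0 \<notin> range c"
    using i y0(2) unfolding k_def by (metis Suc_n_not_le_n rangeE)
  have far: "k \<le> d x (c s)" if x: "adj w x" and s: "adj (c i) (c s)" for x s
  proof (rule ccontr)
    assume lt: "\<not> k \<le> d x (c s)"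
    have xV: "x \<in> V" using x adj_V by blast
    have "d w (c s) \<le> Suc (d x (c s))"
      using dist_step(1)[OF adj_sym[OF x] cV[of s]] dist_sym[OF wV cV] dist_sym[OF xV cV] by simp
    then have eq: "Suc (d x (c s)) = k" "d w (c s) = k" using lt i[of s] k_def by linarith+
    show False
    proof (cases "x = c s")
      \<comment> \<open>Here \<open>w\<close> itself is adjacent to both \<open>c i\<close> and
        \<open>c s\<close>, and these are adjacent to each other.\<close>
      case True
      then have "k = 1" using eq cV by simp
      then have "adj w (c i)" using dist_1_iff[OF wV cV] k_def by simp
      then show False using no_triangle[of w "c i" "c s"] s x True adj_sym by blast
    next
      case False
      obtain y where y: "adj (c s) y" "Suc (d x y) = d x (c s)" using dist_prev[OF xV cV False] by blast
      have yV: "y \<in> V" using y adj_V by blast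
      have "d w y \<le> Suc (d x y)"
        using dist_step(1)[OF adj_sym[OF x] yV] dist_sym[OF wV yV] dist_sym[OF xV yV] by simp
      then have "d w y < k" using y eq by simp
      then have "y \<notin> range c" using i unfolding k_def by (metis not_le rangeE)
      then show False using no_adjacent_branches[OF s y0(1) y(1) y0_off] by blast
    qed
  qed
  have off: "c s \<notin> set p" if s: "adj (c i) (c s)" for s
  proof
    assume "c s \<in> set p"
    then have "d w (c s) + d (c s) (c i) = k" using geod_set[OF p] k_def by blast
    moreover have "d (c s) (c i) = 1" using s dist_adj adj_sym by blast
    ultimately show False using i[of s] k_def by linarith
  qed
  have "mv {a, b, c (i + 1), c (i - 1)} \<and> card {a, b, c (i + 1), c (i - 1)} = 4"
  proof (rule mv_two_branches[OF p])
    show "w \<noteq> c i" using assms by auto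
  qed (use ab cyc_adj[OF cyc_c, of i] cyc_nbrs_distinct[OF cyc_c, of i] far off k_def in auto)
  then show False using mv_card by force
qed

text \<open>The pairs are \<open>c (-1), a\<close> and \<open>c (int k + 1), b\<close>, joined by
  the arc between. A mixed pair of one cycle and one off-cycle vertex is at most one step closer
  than a cycle pair at distance at least \<open>k + 1\<close>. The pair \<open>a, b\<close> is
  controlled by minimality of the cycle.\<close>

lemma close_branches:
  assumes "1 \<le> k" "2 * k + 2 \<le> n" "adj (c 0) a" "adj (c (int k)) b" "a \<notin> range c" "b \<notin> range c"
  shows False
proof -
  let ?p = "map (\<lambda>i. c (0 + int i)) [0..<Suc k]"
  have D: "int (d (c i) (c j)) = cyc_dist n (i - j)" for i j using shortest_cyc_dist[OF sc] .
  have V: "c i \<in> V" "a \<in> V" "b \<in> V" for i using cyc_V[OF cyc_c] assms adj_V by blast+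
  have dk: "d (c 0) (c (int k)) = k" using D[of 0 "int k"] assms by (simp add: cyc_dist_eq)
  have p: "geod ?p (c 0) (c (int k))"
    using cyc_arc_walk[OF cyc_c, of 0 k] dk by (simp add: geod_def)
  have off: "c j \<notin> set ?p" if "j = -1 \<or> j = int k + 1" for j
  proof
    assume "c j \<in> set ?p"
    then obtain i where "i \<le> k" "c j = c (int i)" by (auto simp: less_Suc_eq_le simp del: upt_Suc)
    then show False using cyc_neq[OF cyc_c, of j "int i"] that assms n_ge_4 by auto
  qed
  have "mv {c (-1), a, c (int k + 1), b} \<and> card {c (-1), a, c (int k + 1), b} = 4"
  proof (rule mv_two_branches[OF p])
    show "c 0 \<noteq> c (int k)" using assms by (intro cyc_neq[OF cyc_c]) auto
    show "adj (c 0) (c (-1))" using cyc_adj(2)[OF cyc_c, of 0] by simp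
    show "adj (c (int k)) (c (int k + 1))" using cyc_adj(1)[OF cyc_c] .
    show "a \<notin> set ?p" "b \<notin> set ?p" "c (-1) \<noteq> a" "c (int k + 1) \<noteq> b" using assms by auto
    show "c (-1) \<notin> set ?p" "c (int k + 1) \<notin> set ?p" using off by auto
    have "int (d (c (int k + 1)) (c (-1))) = min (int k + 2) (int n - int k - 2)"
      using D[of "int k + 1" "-1"] assms n_ge_4 by (simp add: cyc_dist_eq)
    then show "d (c 0) (c (int k)) \<le> d (c (-1)) (c (int k + 1))"
      using dk assms dist_sym[OF V(1) V(1), of "-1" "int k + 1"] by linarith
    have "int (d (c (int k)) (c (-1))) = min (int k + 1) (int n - int k - 1)"
      using D[of "int k" "-1"] assms n_ge_4 by (simp add: cyc_dist_eq)
    then show "d (c 0) (c (int k)) \<le> d (c (-1)) b"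
      using dk assms(2) dist_sym[OF V(1) V(1), of "int k" "-1"] dist_sym[OF V(3) V(1), of "-1"] dist_sym[OF V(1) V(3), of "-1"]
        dist_sym[OF V(1) V(1), of "-1" "int k"] dist_step(2)[OF assms(4) V(1)[of "-1"]] by linarith
    have "int (d (c (int k + 1)) (c 0)) = min (int k + 1) (int n - int k - 1)"
      using D[of "int k + 1" "0"] assms n_ge_4 by (simp add: cyc_dist_eq)
    then show "d (c 0) (c (int k)) \<le> d a (c (int k + 1))"
      using dk assms(2) dist_sym[OF V(1) V(1), of "int k + 1" 0] dist_sym[OF V(2) V(1)[of "int k + 1"]]
        dist_step(2)[OF assms(3) V(1)[of "int k + 1"]] by linarith
    \<comment> \<open>A connection of \<open>a\<close> and \<open>b\<close> of length below
      \<open>k\<close>, closed up by the arc and \<open>c 0\<close>, gives a cycle of length at most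
      \<open>2 * k + 1 < n\<close>.\<close>
    show "d (c 0) (c (int k)) \<le> d a b"
    proof (rule ccontr)
      assume "\<not> ?thesis"
      then have lt: "d b a < k" using dk dist_sym[OF V(2,3)] by simp
      obtain q where q: "geod q b a" using ex_geod V by blast
      have q': "walk q" "hd q = b" "last q = a" "length q = Suc (d b a)" "q \<noteq> []"
        using q by (auto simp: geod_def walk_def)
      have "c 0 \<notin> set q"
      proof
        assume "c 0 \<in> set q"
        then have "d b (c 0) + d (c 0) a = d b a" using geod_set[OF q] by blast
        moreover have "k \<le> Suc (d b (c 0))"
          using dist_step(2)[OF assms(4) V(1)[of 0]] dk dist_sym[OF V(3) V(1)[of 0]] by simp
        ultimately show False using dist_adj[OF assms(3)] lt by linarith
      qed
      let ?r = "map (\<lambda>i. c (1 + int i)) [0..<Suc (k - 1)]"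
      have r: "walk ?r" "hd ?r = c 1" "last ?r = c (int k)" "length ?r = k"
        using cyc_arc_walk[OF cyc_c, of 1 "k - 1"] assms(1) by (auto simp: of_nat_diff simp del: upt_Suc)
      have "c 0 \<notin> set ?r"
      proof
        assume "c 0 \<in> set ?r"
        then obtain i where "i < k" "c 0 = c (1 + int i)" using assms(1) by (auto simp del: upt_Suc)
        then show False using cyc_neq[OF cyc_c, of 0 "1 + int i"] assms by auto
      qed
      have "?r \<noteq> []" by simp
      have "n \<le> Suc (length (?r @ q))"
      proof (rule shortest_cyc_detour[OF sc])
        show "adj (c 0) (c 1)" using cyc_adj(1)[OF cyc_c, of 0] by simp
        show "adj (c 0) a" using assms by simp
        show "c 1 \<noteq> a" using assms by auto
        show "walk (?r @ q)" using q' r assms(4) by (intro walk_append) (auto simp del: upt_Suc)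
        show "hd (?r @ q) = c 1" using r \<open>?r \<noteq> []\<close> by (simp del: upt_Suc)
        show "last (?r @ q) = a" using q' by simp
        show "c 0 \<notin> set (?r @ q)" using \<open>c 0 \<notin> set q\<close> \<open>c 0 \<notin> set ?r\<close> by (simp del: upt_Suc)
      qed
      then show False using r q' lt assms by (simp del: upt_Suc)
    qed
  qed (use assms in auto)
  then show False using mv_card by force
qed

end

text \<open>\<open>close_branches\<close> rules out every positive cyclic distance \<open>k\<close>
  with \<open>2 * k + 2 \<le> n\<close>; only n div 2 is left. A rotation puts the first of the two
  vertices at index 0.\<close>

lemma branches_antipodal:
  assumes sc: "shortest_cyc n c"
    and "adj (c i) a" "adj (c j) b" "a \<notin> range c" "b \<notin> range c" "c i \<noteq> c j"
  shows "cyc_dist n (i - j) = int n div 2"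
proof -
  have c: "cyc n c" and n: "0 < n" using shortest_cyc_cyc[OF sc] by (auto simp: cyc_def)
  define k where "k = nat (cyc_dist n (i - j))"
  have k: "int k = cyc_dist n (i - j)" using cyc_dist_nonneg[OF n] by (simp add: k_def)
  have "cyc_dist n (i - j) \<noteq> 0" using cyc_eq_iff[OF c, of i j] cyc_dist_0_iff[OF n] assms by simp
  then have k1: "1 \<le> k" using k by linarith
  have "\<not> 2 * k + 2 \<le> n"
  proof
    assume k2: "2 * k + 2 \<le> n"
    have "int n dvd i - j - int k \<or> int n dvd i - j + int k"
      using cyc_dist_cases[OF n, of "i - j"] k by simp
    then have "c i = c (j + int k) \<or> c j = c (i + int k)"
      unfolding cyc_eq_iff[OF c] by (simp add: dvd_diff_commute[of _ j] algebra_simps)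
    then show False
    proof
      assume "c i = c (j + int k)"
      then show False
        using close_branches[OF shortest_cyc_shift[OF sc, of j] k1 k2, of b a] assms by auto
    next
      assume "c j = c (i + int k)"
      then show False
        using close_branches[OF shortest_cyc_shift[OF sc, of i] k1 k2, of a b] assms by auto
    qed
  qed
  then show ?thesis using cyc_dist_half[OF n, of "i - j"] k by linarith
qed

text \<open>Let h be n div 2. Modulo n, both \<open>i - j\<close> and \<open>i - l\<close> are h or
  -h. Equal signs identify \<open>c j\<close> and \<open>c l\<close>. Opposite signs make
  \<open>j - l\<close> congruent to 2h or -2h, that is to 0, 1 or -1, so \<open>c j\<close> and
  \<open>c l\<close> coincide or are adjacent, not antipodal.\<close>

lemma three_branches:
  assumes sc: "shortest_cyc n c"
    and br: "adj (c i) a" "adj (c j) b" "adj (c l) e" "a \<notin> range c" "b \<notin> range c" "e \<notin> range c"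
    and ne: "c i \<noteq> c j" "c i \<noteq> c l" "c j \<noteq> c l"
  shows False
proof -
  have c: "cyc n c" using shortest_cyc_cyc[OF sc] .
  have n: "4 \<le> n" using cyc_ge_4[OF c] .
  have np: "0 < n" using n by simp
  define h where "h = int n div 2"
  have ij: "cyc_dist n (i - j) = h" unfolding h_def by (rule branches_antipodal[OF sc]) fact+
  have il: "cyc_dist n (i - l) = h" unfolding h_def by (rule branches_antipodal[OF sc]) fact+
  have jl: "cyc_dist n (j - l) = h" unfolding h_def by (rule branches_antipodal[OF sc]) fact+
  have A: "int n dvd i - j - h \<or> int n dvd i - j + h" using cyc_dist_cases[OF np, of "i - j"] ij by simp
  have B: "int n dvd i - l - h \<or> int n dvd i - l + h" using cyc_dist_cases[OF np, of "i - l"] il by simp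
  have nd: "\<not> int n dvd j - l" using ne cyc_eq_iff[OF c] by simp
  have "int n dvd j - l - 2 * h \<or> int n dvd j - l + 2 * h"
    using A B
  proof (elim disjE)
    assume "int n dvd i - j - h" "int n dvd i - l - h"
    then have "int n dvd (i - l - h) - (i - j - h)" using dvd_diff by blast
    then show ?thesis using nd by simp
  next
    assume "int n dvd i - j - h" "int n dvd i - l + h"
    then have "int n dvd (i - l + h) - (i - j - h)" using dvd_diff by blast
    then show ?thesis by (simp add: algebra_simps)
  next
    assume "int n dvd i - j + h" "int n dvd i - l - h"
    then have "int n dvd (i - l - h) - (i - j + h)" using dvd_diff by blast
    then show ?thesis by (simp add: algebra_simps)
  next
    assume "int n dvd i - j + h" "int n dvd i - l + h"
    then have "int n dvd (i - l + h) - (i - j + h)" using dvd_diff by blast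
    then show ?thesis using nd by simp
  qed
  moreover have "2 * h = int n \<or> 2 * h = int n - 1" unfolding h_def by linarith
  ultimately have "int n dvd j - l - 1 \<or> int n dvd j - l + 1"
  proof (elim disjE)
    assume "int n dvd j - l - 2 * h" "2 * h = int n"
    then have "int n dvd (j - l - int n) + int n" by (intro dvd_add) auto
    then show ?thesis using nd by simp
  next
    assume "int n dvd j - l - 2 * h" "2 * h = int n - 1"
    then have "int n dvd (j - l - (int n - 1)) + int n" by (intro dvd_add) auto
    then show ?thesis by (simp add: algebra_simps)
  next
    assume "int n dvd j - l + 2 * h" "2 * h = int n"
    then have "int n dvd j - l + int n" by simp
    then have "int n dvd (j - l + int n) - int n" by (rule dvd_diff) simp
    then show ?thesis using nd by simp
  next
    assume "int n dvd j - l + 2 * h" "2 * h = int n - 1"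
    then have "int n dvd j - l + (int n - 1)" by simp
    then have "int n dvd (j - l + (int n - 1)) - int n" by (rule dvd_diff) simp
    then show ?thesis by (simp add: algebra_simps)
  qed
  then have "cyc_dist n (j - l) = 1" using n by (simp add: cyc_dist_1_iff)
  then show False using jl n unfolding h_def by simp
qed

end

section \<open>No second cycle through two antipodal branch vertices\<close>

context small_mv_graph
begin

text \<open>\<open>w\<close> is an ear: a path of length \<open>l\<close> outside the cycle joining
  \<open>c 0\<close> to its antipode \<open>c (int k)\<close>, with inner vertices of degree 2. A
  vertex \<open>T\<close> of the ear about halfway round the cycle formed by the ear and one arc has
  \<open>c 0\<close> as a local maximum of its distance function. \<open>T\<close> and the three
  neighbours of \<open>c 0\<close> then form a visible set of size 4.\<close>

lemma no_theta:
  fixes w :: "nat \<Rightarrow> 'a"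
  assumes sc: "shortest_cyc n c" and k: "k = n div 2"
    and l: "2 \<le> l" "w 0 = c 0" "w l = c (int k)"
    and w_adj: "\<And>t. t < l \<Longrightarrow> adj (w t) (w (Suc t))"
    and off: "\<And>t. 0 < t \<Longrightarrow> t < l \<Longrightarrow> w t \<notin> range c"
    and w_nbrs: "\<And>t y. 0 < t \<Longrightarrow> t < l \<Longrightarrow> adj (w t) y \<Longrightarrow> y = w (t - 1) \<or> y = w (Suc t)"
  shows False
proof -
  have c: "cyc n c" using shortest_cyc_cyc[OF sc] .
  have n: "4 \<le> n" using cyc_ge_4[OF c] .
  have k2: "2 \<le> k" "n \<le> 2 * k + 1" "2 * k \<le> n" using n k by linarith+
  have D: "int (d (c i) (c j)) = cyc_dist n (i - j)" for i j using shortest_cyc_dist[OF sc] .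
  have cV: "c i \<in> V" for i using cyc_V[OF c] .
  have wV: "w t \<in> V" if "t \<le> l" for t
    using that l cV w_adj[of t] adj_V(1)[of "w t" "w (Suc t)"] by (cases "t = l") auto
  have a0: "adj (c 0) (c 1)" "adj (c 0) (c (-1))" "adj (c 0) (w 1)"
    using cyc_adj[OF c, of 0] w_adj[of 0] l by auto
  have w1: "w 1 \<notin> range c" using off[of 1] l by simp
  have dk: "d (c 0) (c (int k)) = k" using D[of 0 "int k"] k2 by (simp add: cyc_dist_eq)
  \<comment> \<open>The ear closed by an arc of length \<open>k\<close> is a cycle of length
    \<open>l + k\<close>, hence not shorter than \<open>n\<close>.\<close>
  have lk: "n \<le> l + k"
  proof -
    let ?q = "map w [1..<l]"
    let ?r = "map (\<lambda>i. c (int k - int i)) [0..<k]"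
    have r: "walk ?r \<and> hd ?r = c (int k) \<and> last ?r = c 1"
      using cyc_arc_walk[OF cyc_rev[OF c, of "int k"], of 0 "k - 1"] k2 by (simp add: of_nat_diff del: upt_Suc)
    have "successively adj ?q" using w_adj by (auto simp: successively_conv_nth)
    then have q: "walk ?q" using wV l by (auto simp: walk_def)
    have "n \<le> Suc (length (?q @ ?r))"
    proof (rule shortest_cyc_detour[OF sc a0(3,1)])
      show "w 1 \<noteq> c 1" using w1 by auto
      have "last ?q = w (l - 1)" using l by (simp add: last_map)
      moreover have "adj (w (l - 1)) (w l)" using w_adj[of "l - 1"] l by simp
      ultimately show "walk (?q @ ?r)" using q r l by (intro walk_append) auto
      show "hd (?q @ ?r) = w 1" using l by (simp add: hd_map)
      show "last (?q @ ?r) = c 1" using r k2 by simp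
      have "c 0 \<notin> set ?r"
      proof
        assume "c 0 \<in> set ?r"
        then obtain i where "i < k" "c 0 = c (int k - int i)" by auto
        then show False using cyc_neq[OF c, of 0 "int k - int i"] k2 by simp
      qed
      moreover have "c 0 \<notin> set ?q"
      proof
        assume "c 0 \<in> set ?q"
        then obtain t where "1 \<le> t" "t < l" "c 0 = w t" by auto
        then show False using off[of t] rangeI[of c 0] by simp
      qed
      ultimately show "c 0 \<notin> set (?q @ ?r)" by auto
    qed
    then show ?thesis using l by simp
  qed
  \<comment> \<open>A shortest path from \<open>c 0\<close> can enter the ear only through its ends,
    at cost 0 or \<open>k\<close>. The induction follows the last edge of such a path.\<close>
  have lower: "min t (l - t + k) \<le> d (c 0) (w t)" if "t \<le> l" for t
    using that
  proof (induction "d (c 0) (w t)" arbitrary: t rule: less_induct)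
    case less
    show ?case
    proof (cases "t = 0 \<or> t = l")
      case True
      then show ?thesis using dk l cV by auto
    next
      case False
      then have t: "0 < t" "t < l" using less.prems by auto
      have "c 0 \<noteq> w t" using off[OF t] by (metis rangeI)
      then obtain y where y: "adj (w t) y" "Suc (d (c 0) y) = d (c 0) (w t)"
        using dist_prev[OF cV[of 0] wV[OF less.prems]] by blast
      from w_nbrs[OF t y(1)] show ?thesis
      proof
        assume "y = w (t - 1)"
        then have "min (t - 1) (l - (t - 1) + k) \<le> d (c 0) y" using less.hyps[of "t - 1"] y t by auto
        then show ?thesis using y t by linarith
      next
        assume "y = w (Suc t)"
        then have "min (Suc t) (l - Suc t + k) \<le> d (c 0) y" using less.hyps[of "Suc t"] y t by auto
        then show ?thesis using y t by linarith
      qed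
    qed
  qed
  \<comment> \<open>Half of the circumference \<open>l + k\<close>, rounded up. Then the way from
    \<open>T\<close> to \<open>c 0\<close> through \<open>c (int k)\<close> is a shortest one, and
    the way along the ear is at most one step longer.\<close>
  define t where "t = (l + k + 1) div 2"
  have t: "2 * t \<le> l + k + 1" "l + k \<le> 2 * t" unfolding t_def by linarith+
  have tl: "t \<le> l" "1 \<le> t" using t lk k2 l by linarith+
  define T where "T = w t"
  have TV: "T \<in> V" using wV tl T_def by simp
  have Dt: "l - t + k \<le> d T (c 0)"
    using lower[OF tl(1)] t tl dist_sym[OF TV cV[of 0]] unfolding T_def by simp
  then have "2 \<le> d T (c 0)" using k2 by linarith
  then have T0: "T \<noteq> c 0" "\<not> adj (c 0) T"
    using cV[of 0] dist_adj[of T "c 0"] adj_sym[of "c 0" T] by auto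
  have Tl: "d T (c (int k)) \<le> l - t"
    using chain_dist[of t l w] w_adj wV tl l T_def by auto
  have "mv (insert T (nbrs (c 0)))"
  proof (rule mv_nbrs_insert[OF TV T0 cV])
    fix x assume "adj (c 0) x"
    then have "x \<in> nbrs (c 0)" by simp
    then have "x \<in> {c (0 + 1), c (0 - 1), w 1}" unfolding branch_nbrs[OF sc a0(3) w1] .
    then consider "x = c 1" | "x = c (-1)" | "x = w 1" by auto
    then show "d T x \<le> d T (c 0)"
    proof cases
      case 1
      have "int (d (c (int k)) (c 1)) = int k - 1" using D[of "int k" 1] k2 by (simp add: cyc_dist_eq)
      then show ?thesis using dist_triangle[OF TV cV[of "int k"] cV[of 1]] Tl Dt unfolding 1 by linarith
    next
      \<comment> \<open>From \<open>c (int k)\<close> to \<open>c (-1)\<close> the remaining arc has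
        length \<open>n - k - 1\<close>, at most \<open>k\<close> because \<open>k\<close> is n div
        2.\<close>
      case 2
      have "int (d (c (int k)) (c (-1))) = min (int k + 1) (int n - int k - 1)"
        using D[of "int k" "-1"] k2 n by (simp add: cyc_dist_eq)
      then have "d (c (int k)) (c (-1)) \<le> k" using k2 by linarith
      then show ?thesis using dist_triangle[OF TV cV[of "int k"] cV[of "-1"]] Tl Dt unfolding 2 by linarith
    next
      case 3
      have "d (w 1) T \<le> t - 1" using chain_dist[of 1 t w] w_adj wV[of 1] tl l T_def by auto
      moreover have "w 1 \<in> V" using a0(3) adj_V by blast
      ultimately show ?thesis using dist_sym[OF TV, of "w 1"] Dt t tl unfolding 3 by linarith
    qed
  qed
  moreover have "card (insert T (nbrs (c 0))) = 4"
  proof -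
    have "c 1 \<noteq> c (-1)" using cyc_nbrs_distinct[OF c, of 0] by simp
    moreover have "c 1 \<noteq> w 1" "c (-1) \<noteq> w 1" using w1 by (metis rangeI)+
    moreover have "nbrs (c 0) = {c 1, c (-1), w 1}" using branch_nbrs[OF sc a0(3) w1] by simp
    moreover have "T \<notin> nbrs (c 0)" using T0 by simp
    ultimately show ?thesis by simp
  qed
  ultimately show False using mv_card by force
qed

text \<open>The list includes its attachment vertex on the cycle. A singleton is allowed and stands
  for the trivial attached path of a frog.\<close>

definition tail :: "(int \<Rightarrow> 'a) \<Rightarrow> 'a list \<Rightarrow> bool" where
  "tail c p \<longleftrightarrow> p \<noteq> [] \<and> distinct p \<and> successively adj p \<and> hd p \<in> range c \<and> set (tl p) \<inter> range c = {}"

section \<open>Maximal tails\<close>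

context
  fixes n :: nat and c :: "int \<Rightarrow> 'a"
  assumes sc: "shortest_cyc n c"
begin

lemma tail_nth_adj: "tail c p \<Longrightarrow> Suc j < length p \<Longrightarrow> adj (p ! j) (p ! Suc j)"
  by (auto simp: tail_def successively_conv_nth)

lemma tail_nth_off: "tail c p \<Longrightarrow> 0 < j \<Longrightarrow> j < length p \<Longrightarrow> p ! j \<notin> range c"
proof -
  assume *: "tail c p" "0 < j" "j < length p"
  then have "p ! j = tl p ! (j - 1)" by (simp add: nth_tl)
  moreover have "tl p ! (j - 1) \<in> set (tl p)" using * by (intro nth_mem) auto
  ultimately have "p ! j \<in> set (tl p)" by simp
  moreover have "set (tl p) \<inter> range c = {}" using * by (simp add: tail_def)
  ultimately show ?thesis by blast
qed

lemma tail_nth_0: "tail c p \<Longrightarrow> p ! 0 = hd p"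
  by (simp add: tail_def hd_conv_nth)

lemma tail_nth_eq: "tail c p \<Longrightarrow> i < length p \<Longrightarrow> j < length p \<Longrightarrow> p ! i = p ! j \<longleftrightarrow> i = j"
  by (simp add: tail_def nth_eq_iff_index_eq)

lemma tail_inner:
  assumes "tail c p" "0 < j" "Suc j < length p" "adj (p ! j) y"
  shows "y = p ! (j - 1) \<or> y = p ! Suc j"
proof (rule ccontr)
  assume "\<not> ?thesis"
  moreover have "adj (p ! j) (p ! Suc j)" using tail_nth_adj[OF assms(1,3)] .
  moreover have "adj (p ! j) (p ! (j - 1))" using tail_nth_adj[OF assms(1), of "j - 1"] assms adj_sym by simp
  moreover have "p ! (j - 1) \<noteq> p ! Suc j" using tail_nth_eq[OF assms(1), of "j - 1" "Suc j"] assms by auto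
  ultimately show False using off_cyc_degree[OF sc tail_nth_off[OF assms(1,2)]] assms by (metis Suc_lessD)
qed

text \<open>Otherwise appending \<open>c j\<close> turns the tail into an ear. Its ends are two
  branch vertices, hence antipodal, and its inner vertices have degree 2 by
  \<open>off_cyc_degree\<close>. A rotation or a reflection then brings it into the position of
  \<open>no_theta\<close>.\<close>

lemma tail_return:
  assumes p: "tail c p" "2 \<le> length p" "adj (last p) (c j)"
  shows "c j = hd p"
proof (rule ccontr)
  assume ne: "c j \<noteq> hd p"
  obtain i where i: "hd p = c i" using p by (auto simp: tail_def)
  define l where "l = length p"
  define w where "w t = (p @ [c j]) ! t" for t
  have wt: "w t = p ! t" if "t < l" for t using that by (simp add: w_def l_def nth_append)
  have wl: "w l = c j" by (simp add: w_def l_def)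
  have w0: "w 0 = c i" using wt[of 0] tail_nth_0[OF p(1)] i p(2) l_def by (cases p) auto
  have last: "last p = p ! (l - 1)" using p by (simp add: l_def last_conv_nth tail_def)
  have w_adj: "adj (w t) (w (Suc t))" if "t < l" for t
  proof (cases "Suc t = l")
    case True
    then show ?thesis using p(3) wt[OF that] wl last by (metis diff_Suc_1)
  next
    case False
    then show ?thesis using tail_nth_adj[OF p(1), of t] wt that by (simp add: l_def)
  qed
  have off: "w t \<notin> range c" if "0 < t" "t < l" for t
    using tail_nth_off[OF p(1), of t] wt that by (simp add: l_def)
  have w_nbrs: "y = w (t - 1) \<or> y = w (Suc t)" if t: "0 < t" "t < l" "adj (w t) y" for t y
  proof (rule ccontr)
    assume "\<not> ?thesis"
    moreover have "adj (w t) (w (t - 1))" using w_adj[of "t - 1"] t adj_sym by simp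
    moreover have "w (t - 1) \<noteq> w (Suc t)"
    proof (cases "Suc t = l")
      case True
      show ?thesis
      proof (cases "t = 1")
        case True
        then show ?thesis using \<open>Suc t = l\<close> wl w0 ne i by simp
      next
        case False
        then have "0 < t - 1" "t - 1 < l" using t by linarith+
        then have "w (t - 1) \<notin> range c" by (rule off)
        then show ?thesis using True wl by auto
      qed
    next
      case False
      then show ?thesis using wt t tail_nth_eq[OF p(1), of "t - 1" "Suc t"] by (simp add: l_def)
    qed
    ultimately show False using off_cyc_degree[OF sc off[OF t(1,2)]] w_adj[OF t(2)] t(3) by metis
  qed
  have l2: "2 \<le> l" using p l_def by simp
  have "adj (c i) (w 1)" "w 1 \<notin> range c" using w_adj[of 0] w0 off[of 1] l2 by auto
  moreover have "adj (c j) (w (l - 1))" "w (l - 1) \<notin> range c"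
    using w_adj[of "l - 1"] wl adj_sym off[of "l - 1"] l2 by auto
  ultimately have h: "cyc_dist n (j - i) = int n div 2"
    using branches_antipodal[OF sc] ne i by metis
  have c: "cyc n c" using shortest_cyc_cyc[OF sc] .
  have n0: "0 < n" using cyc_ge_4[OF c] by simp
  let ?k = "n div 2"
  have "int n dvd j - i - int ?k \<or> int n dvd j - i + int ?k"
    using cyc_dist_cases[OF n0, of "j - i"] h by (simp add: zdiv_int)
  then have "c j = c (i + int ?k) \<or> c j = c (i - int ?k)"
    unfolding cyc_eq_iff[OF c] by (simp add: algebra_simps)
  then show False
  proof
    assume "c j = c (i + int ?k)"
    then show False
      using no_theta[OF shortest_cyc_shift[OF sc, of i] refl l2, of w] w0 wl w_adj off w_nbrs by auto
  next
    assume "c j = c (i - int ?k)"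
    then show False
      using no_theta[OF shortest_cyc_rev[OF sc, of i] refl l2, of w] w0 wl w_adj off w_nbrs by auto
  qed
qed

text \<open>Maximal in length among all tails with the same root, not merely non-extendable. One
  always exists, since a tail has at most \<open>card V\<close> vertices.\<close>

definition full_tail :: "'a list \<Rightarrow> bool" where
  "full_tail p \<longleftrightarrow> tail c p \<and> (\<forall>q. tail c q \<and> hd q = hd p \<longrightarrow> length q \<le> length p)"

lemma ex_full_tail: "\<exists>p. full_tail p \<and> hd p = c i"
proof -
  let ?P = "\<lambda>p. tail c p \<and> hd p = c i"
  have "length p < Suc (card V)" if "?P p" for p
  proof -
    have "set p \<subseteq> V"
    proof
      fix x assume "x \<in> set p"
      then obtain j where j: "j < length p" "x = p ! j" by (auto simp: in_set_conv_nth)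
      show "x \<in> V"
      proof (cases j)
        case 0
        then show ?thesis using j that tail_nth_0 cyc_V[OF shortest_cyc_cyc[OF sc]] by metis
      next
        case (Suc m)
        then show ?thesis using j that tail_nth_adj[of p m] adj_V by blast
      qed
    qed
    then have "card (set p) \<le> card V" using finite_V card_mono by blast
    then show ?thesis using that by (auto simp: tail_def distinct_card)
  qed
  moreover have "?P [c i]" by (simp add: tail_def)
  ultimately obtain p where "?P p" "\<forall>q. ?P q \<longrightarrow> length q \<le> length p"
    using ex_has_greatest_nat[of ?P "[c i]" length] by blast
  then show ?thesis by (auto simp: full_tail_def intro!: exI[of _ p])
qed

lemma tail_snoc:
  assumes "tail c p" "adj (last p) y" "y \<notin> set p" "y \<notin> range c"
  shows "tail c (p @ [y]) \<and> hd (p @ [y]) = hd p"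
  using assms by (auto simp: tail_def successively_append_iff)

text \<open>Only the last vertex needs an argument. A neighbour on the cycle is the root by
  \<open>tail_return\<close>, and as the root has one off-cycle neighbour, the tail then has length
  2. A neighbour off the cycle lies on the tail by maximality, and the degree bound leaves only the
  predecessor.\<close>

lemma full_tail_nbrs:
  assumes p: "full_tail p" and j: "0 < j" "j < length p" "adj (p ! j) y"
  shows "y = p ! (j - 1) \<or> (Suc j < length p \<and> y = p ! Suc j)"
proof (cases "Suc j < length p")
  case True
  then show ?thesis using tail_inner[of p j y] p j by (auto simp: full_tail_def)
next
  case False
  then have jl: "length p = Suc j" using j by simp
  have t: "tail c p" using p by (simp add: full_tail_def)
  have last: "last p = p ! j" using t jl by (simp add: tail_def last_conv_nth)
  have 1: "y = p ! (j - 1)" if i: "y = p ! i" "i < length p" for i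
  proof -
    have "i \<noteq> j" using i j by auto
    then have ij: "i < j" using i jl by simp
    show ?thesis
    proof (cases "i = 0")
      case True
      then obtain m where m: "y = c m" using i t tail_nth_0[OF t] by (auto simp: tail_def)
      have "adj (c m) (p ! j)" using j m adj_sym by simp
      moreover have "adj (c m) (p ! 1)" using tail_nth_adj[OF t, of 0] i True m jl j by simp
      ultimately have "p ! j = p ! 1"
        using branch_unique[OF sc] tail_nth_off[OF t, of j] tail_nth_off[OF t, of 1] j jl by simp
      then have "j = 1" using tail_nth_eq[OF t, of j 1] jl j by simp
      then show ?thesis using i True by simp
    next
      case False
      then have "p ! j = p ! (i - 1) \<or> p ! j = p ! Suc i"
        using tail_inner[OF t, of i "p ! j"] i ij jl j(3) adj_sym by simp
      then have "j = Suc i" using tail_nth_eq[OF t] ij jl by auto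
      then show ?thesis using i by simp
    qed
  qed
  show ?thesis
  proof (cases "y \<in> range c")
    case True
    then obtain m where m: "y = c m" by auto
    then have "y = hd p" using tail_return[OF t, of m] j jl last by simp
    then have "y = p ! 0" using tail_nth_0[OF t] by simp
    moreover have "0 < length p" using j by linarith
    ultimately show ?thesis using 1[of 0] by simp
  next
    case False
    then have "y \<in> set p"
      using tail_snoc[OF t, of y] last j p unfolding full_tail_def by force
    then show ?thesis using 1 by (auto simp: in_set_conv_nth)
  qed
qed

lemma full_tail_root:
  assumes p: "full_tail p" and y: "adj (hd p) y" "y \<notin> range c"
  shows "1 < length p \<and> y = p ! 1"
proof -
  have t: "tail c p" using p by (simp add: full_tail_def)
  obtain i where i: "hd p = c i" using t by (auto simp: tail_def)
  have "1 < length p"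
  proof (rule ccontr)
    assume "\<not> 1 < length p"
    then obtain x where x: "p = [x]" using t by (cases p) (auto simp: tail_def)
    then have "tail c (p @ [y]) \<and> hd (p @ [y]) = hd p"
      using y i by (intro tail_snoc[OF t]) auto
    then show False using p x unfolding full_tail_def by force
  qed
  moreover from this have "y = p ! 1"
    using branch_unique[OF sc, of i y "p ! 1"] tail_nth_adj[OF t, of 0] tail_nth_0[OF t] tail_nth_off[OF t, of 1] i y
    by simp
  ultimately show ?thesis by simp
qed

text \<open>A common vertex can be pushed back along \<open>q\<close>: by
  \<open>full_tail_nbrs\<close>, its predecessor in \<open>q\<close> also lies on \<open>p\<close>.
  This ends at the root of \<open>q\<close>, a cycle vertex, which would have to be the root of
  \<open>p\<close>.\<close>

lemma full_tails_disjoint: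
  assumes p: "full_tail p" and q: "full_tail q" and ne: "hd p \<noteq> hd q"
  shows "set p \<inter> set q = {}"
proof -
  have t: "tail c p" "tail c q" using p q by (auto simp: full_tail_def)
  have "q ! j \<notin> set p" if "j < length q" for j
    using that
  proof (induction j)
    case 0
    show ?case
    proof
      assume "q ! 0 \<in> set p"
      then obtain i where i: "i < length p" "p ! i = q ! 0" by (auto simp: in_set_conv_nth)
      have "q ! 0 \<in> range c" using tail_nth_0[OF t(2)] t(2) by (auto simp: tail_def)
      then have "i = 0" using tail_nth_off[OF t(1), of i] i by force
      then show False using i ne tail_nth_0 t by metis
    qed
  next
    case (Suc j)
    show ?case
    proof
      assume "q ! Suc j \<in> set p"
      then obtain i where i: "i < length p" "p ! i = q ! Suc j" by (auto simp: in_set_conv_nth)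
      have "i \<noteq> 0"
        using i tail_nth_0[OF t(1)] tail_nth_off[OF t(2), of "Suc j"] Suc.prems t(1)
        by (metis tail_def zero_less_Suc)
      moreover have "adj (p ! i) (q ! j)"
        using tail_nth_adj[OF t(2), of j] Suc.prems i adj_sym by simp
      ultimately have "q ! j = p ! (i - 1) \<or> (Suc i < length p \<and> q ! j = p ! Suc i)"
        using full_tail_nbrs[OF p, of i] i by simp
      then have "q ! j \<in> set p" using i by auto
      then show False using Suc by simp
    qed
  qed
  then show ?thesis by (metis disjoint_iff in_set_conv_nth)
qed

text \<open>With fewer than two branch vertices the pair is completed by an antipode. So two
  attachment points always exist, possibly carrying trivial tails.\<close>

lemma branches_within_antipodal_pair:
  "\<exists>i j. cyc_dist n (i - j) = int n div 2 \<and> (\<forall>k a. adj (c k) a \<and> a \<notin> range c \<longrightarrow> c k = c i \<or> c k = c j)"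
proof -
  define R where "R k \<longleftrightarrow> (\<exists>a. adj (c k) a \<and> a \<notin> range c)" for k
  have n: "4 \<le> n" using cyc_ge_4[OF shortest_cyc_cyc[OF sc]] .
  have D: "cyc_dist n (i - (i + int n div 2)) = int n div 2" for i
  proof -
    have "cyc_dist n (i - (i + int n div 2)) = cyc_dist n (int n div 2)"
      by (subst cyc_dist_commute) simp
    then show ?thesis using n by (simp add: cyc_dist_eq)
  qed
  show ?thesis
  proof (cases "\<exists>i. R i")
    case False
    then show ?thesis using D[of 0] unfolding R_def by metis
  next
    case True
    then obtain i where i: "R i" by blast
    show ?thesis
    proof (cases "\<exists>j. R j \<and> c j \<noteq> c i")
      case False
      then show ?thesis using D[of i] unfolding R_def by metis
    next
      case True
      then obtain j where j: "R j" "c j \<noteq> c i" by blast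
      have "cyc_dist n (i - j) = int n div 2"
        using branches_antipodal[OF sc] i j unfolding R_def by metis
      moreover have "c k = c i \<or> c k = c j" if "R k" for k
        using three_branches[OF sc] i j that unfolding R_def by metis
      ultimately show ?thesis unfolding R_def by blast
    qed
  qed
qed

end

end

section \<open>Trees\<close>

context conn_graph
begin

lemma card_nbrs_leaves: "leaves G = {v \<in> V. card (nbrs v) = 1}"
proof -
  have "out_degree (with_proj G) v = card (nbrs v)" for v
  proof -
    have "out_arcs (with_proj G) v = Pair v ` nbrs v"
      by (auto simp: out_arcs_def adj_def)
    then show ?thesis by (simp add: out_degree_def card_image inj_on_def)
  qed
  then show ?thesis by (simp add: leaves_def)
qed

text \<open>An inner vertex of a geodesic has two distinct neighbours on it, so it is no
  leaf.\<close>

lemma mv_leaves: "mv (leaves G)"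
proof (rule mvI)
  show "leaves G \<subseteq> V" by (auto simp: leaves_def)
  fix x y assume xy: "x \<in> leaves G" "y \<in> leaves G" "x \<noteq> y"
  then have V: "x \<in> V" "y \<in> V" by (auto simp: leaves_def)
  obtain p where p: "geod p x y" using ex_geod V by blast
  have w: "walk p" "hd p = x" "last p = y" "p \<noteq> []" using p by (auto simp: geod_def walk_def)
  have "z = x \<or> z = y" if z: "z \<in> set p" "z \<in> leaves G" for z
  proof (rule ccontr)
    assume "\<not> ?thesis"
    then have ne: "z \<noteq> x" "z \<noteq> y" by auto
    obtain i where i: "i < length p" "p ! i = z" using z by (auto simp: in_set_conv_nth)
    have "i \<noteq> 0" using i ne w by (metis hd_conv_nth)
    moreover have "i \<noteq> length p - 1" using i ne w by (metis last_conv_nth)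
    ultimately have ij: "0 < i" "Suc i < length p" using i by linarith+
    have "adj z (p ! (i - 1))" using walk_nth_adj[OF w(1), of "i - 1"] ij i adj_sym by simp
    moreover have "adj z (p ! Suc i)" using walk_nth_adj[OF w(1) ij(2)] i by simp
    moreover have "p ! (i - 1) \<noteq> p ! Suc i"
      using nth_eq_iff_index_eq[OF geod_distinct[OF p], of "i - 1" "Suc i"] ij by simp
    moreover from calculation have "card {p ! (i - 1), p ! Suc i} \<le> card (nbrs z)"
      by (intro card_mono) auto
    ultimately show False using z by (simp add: card_nbrs_leaves)
  qed
  then have "set p \<inter> leaves G = {x, y}" using xy geod_ends[OF p] by blast
  then show "mutually_visible G (leaves G) x y" using p by (auto simp: mutually_visible_iff)
qed

section \<open>Betweenness in acyclic graphs\<close>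

context
  assumes acyclic: "\<nexists>n c. cyc n c"
begin

text \<open>Geodesics to \<open>t\<close> from two neighbours that are not farther away than
  \<open>v\<close> avoid \<open>v\<close>; joined at \<open>t\<close> they form a detour around
  \<open>v\<close> and hence a cycle.\<close>

lemma tree_parent_unique:
  assumes t: "t \<in> V" "v \<noteq> t" and w: "adj v w" "adj v w'" "d t w \<le> d t v" "d t w' \<le> d t v"
  shows "w = w'"
proof (rule ccontr)
  assume ne: "w \<noteq> w'"
  have V: "v \<in> V" "w \<in> V" "w' \<in> V" using w adj_V by blast+
  have avoid: "v \<notin> set p" if p: "geod p x t" and x: "x \<in> V" "d t x \<le> d t v" "x \<noteq> v" for p x
  proof
    assume "v \<in> set p"
    then have "d x v + d v t = d x t" using geod_set p by blast
    moreover have "1 \<le> d x v" using dist_pos x V by blast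
    ultimately show False using x dist_sym[of x t] dist_sym[of v t] V t by simp
  qed
  obtain p q where p: "geod p w t" and q: "geod q w' t" using ex_geod V t by meson
  have vw: "w \<noteq> v" "w' \<noteq> v" using w adj_irrefl by metis+
  have pw: "walk p" "hd p = w" "last p = t" "p \<noteq> []" using p by (auto simp: geod_def walk_def)
  have "walk q" "hd q = w'" "last q = t" "q \<noteq> []" using q by (auto simp: geod_def walk_def)
  then have qw: "walk (rev q)" "hd (rev q) = t" "last (rev q) = w'" "q \<noteq> []"
    by (simp_all add: walk_rev hd_rev last_rev)
  have "walk (p @ tl (rev q))" using pw qw by (intro walk_append_tl) auto
  moreover have "last (p @ tl (rev q)) = w'"
    using pw qw by (cases "rev q") (auto split: if_splits)
  moreover have "v \<notin> set (p @ tl (rev q))"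
    using avoid[OF p V(2) w(3) vw(1)] avoid[OF q V(3) w(4) vw(2)] list.set_sel(2)[of "rev q"] qw by auto
  ultimately show False using cyc_if_detour[OF w(1,2) ne, of "p @ tl (rev q)"] pw acyclic by auto
qed

text \<open>Induction on the distance to \<open>y\<close>. One step towards \<open>y\<close> from
  \<open>z\<close> and from \<open>z'\<close> reaches the same vertex by induction, and both are its
  parent in the direction of \<open>x\<close>.\<close>

lemma tree_between_unique:
  assumes V: "x \<in> V" "y \<in> V" "z \<in> V" "z' \<in> V"
    and z: "d x z + d z y = d x y" "d x z' + d z' y = d x y" "d x z = d x z'"
  shows "z = z'"
  using V(3,4) z
proof (induction "d z y" arbitrary: z z')
  case 0
  then have "d z' y = 0" by linarith
  then show ?case using 0 dist_eq_0 V by metis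
next
  case (Suc m)
  have step: "\<exists>u. adj z u \<and> Suc (d u y) = d z y \<and> d x u = Suc (d x z) \<and> d x u + d u y = d x y"
    if z: "z \<in> V" "d z y = Suc m" "d x z + d z y = d x y" for z
  proof -
    have "y \<noteq> z" using z by auto
    then obtain u where u: "adj z u" "Suc (d y u) = d y z" using dist_prev[OF V(2) z(1)] by blast
    have uV: "u \<in> V" using u adj_V by blast
    have eq: "Suc (d u y) = d z y" using u dist_sym[OF V(2) uV] dist_sym[OF V(2) z(1)] by simp
    moreover have "d x u \<le> Suc (d x z)" using dist_step(1)[OF u(1) V(1)] .
    moreover have "d x y \<le> d x u + d u y" using dist_triangle V uV by blast
    ultimately show ?thesis using u z by (intro exI[of _ u]) linarith
  qed
  obtain u where u: "adj z u" "Suc (d u y) = d z y" "d x u = Suc (d x z)" "d x u + d u y = d x y"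
    using step[of z] Suc by auto
  have "d z' y = Suc m" using Suc by linarith
  then obtain u' where u': "adj z' u'" "Suc (d u' y) = d z' y" "d x u' = Suc (d x z')" "d x u' + d u' y = d x y"
    using step[of z'] Suc by auto
  have "u = u'" using Suc.hyps u u' adj_V Suc.prems by (intro Suc.hyps(1)) auto
  moreover have "u \<noteq> x" using u V by auto
  moreover have "adj u z" "adj u' z'" using u(1) u'(1) adj_sym by blast+
  moreover have "d x z \<le> d x u" "d x z' \<le> d x u'" using u(3) u'(3) by linarith+
  ultimately show ?case using tree_parent_unique[OF V(1), of u z z'] by blast
qed

text \<open>The vertex of a visible geodesic at the same distance from \<open>x\<close> as
  \<open>z\<close> must be \<open>z\<close> itself, so \<open>z\<close> would block the
  pair.\<close>

lemma tree_mv_between: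
  assumes X: "mv X" "x \<in> X" "y \<in> X" "z \<in> X" and z: "d x z + d z y = d x y"
  shows "z = x \<or> z = y"
proof (rule ccontr)
  assume ne: "\<not> ?thesis"
  have V: "x \<in> V" "y \<in> V" "z \<in> V" using X by (auto simp: mutual_visibility_set_def)
  have xy: "x \<noteq> y"
  proof
    assume "x = y"
    then have "d x z = 0" using z V by simp
    then show False using ne dist_eq_0 V by blast
  qed
  then obtain p where p: "geod p x y" "set p \<inter> X = {x, y}" using mv_geod[OF X(1-3)] by blast
  have i: "d x z < length p" using p z by (simp add: geod_def)
  have "p ! d x z \<in> V" using i p by (auto simp: geod_def walk_def)
  moreover have "d x (p ! d x z) = d x z" using geod_split(1)[OF p(1) i] .
  moreover have "d x (p ! d x z) + d (p ! d x z) y = d x y" using geod_set[OF p(1)] i by simp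
  ultimately have "p ! d x z = z" using tree_between_unique[of x y "p ! d x z" z] V z by simp
  then have "z \<in> set p" using i nth_mem by metis
  then show False using p X ne by blast
qed

text \<open>A vertex farthest from \<open>y\<close> among those beyond \<open>x\<close> is a leaf: a
  neighbour farther from \<open>y\<close> would still be beyond \<open>x\<close>, and all other
  neighbours coincide with the parent.\<close>

lemma tree_leaf_beyond:
  assumes V: "x \<in> V" "y \<in> V" "x \<noteq> y"
  shows "\<exists>v\<in>leaves G. d y v = d y x + d x v"
proof -
  let ?S = "{v \<in> V. d y v = d y x + d x v}"
  have S: "finite ?S" "x \<in> ?S" using finite_V V by auto
  then have m: "Max (d y ` ?S) \<in> d y ` ?S" by (intro Max_in) auto
  then obtain v where v: "v \<in> V" "d y v = d y x + d x v" "d y v = Max (d y ` ?S)" by auto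
  have max: "d y u \<le> d y v" if "u \<in> V" "d y u = d y x + d x u" for u
    unfolding v(3) using S that by (intro Max_ge) auto
  have "1 \<le> d y x" using dist_pos V by metis
  then have yv: "y \<noteq> v" using v V by auto
  obtain w where w: "adj v w" "Suc (d y w) = d y v" using dist_prev[OF V(2) v(1) yv] by blast
  have "u = w" if u: "adj v u" for u
  proof -
    have uV: "u \<in> V" using u adj_V by blast
    have "d y u \<le> d y v"
    proof (rule ccontr)
      assume gt: "\<not> d y u \<le> d y v"
      then have "d y u = Suc (d y v)" using dist_step(1)[OF u V(2)] by linarith
      moreover have "d x u \<le> Suc (d x v)" using dist_step(1)[OF u V(1)] .
      moreover have "d y u \<le> d y x + d x u" using dist_triangle V uV by blast
      ultimately have "d y u = d y x + d x u" using v(2) by linarith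
      then show False using max[OF uV] gt by blast
    qed
    then show ?thesis using tree_parent_unique[OF V(2) yv[symmetric] u w(1)] w(2) by simp
  qed
  then have "nbrs v = {w}" unfolding nbrs_def using w by blast
  then have "v \<in> leaves G" using v by (simp add: card_nbrs_leaves)
  then show ?thesis using v by blast
qed

text \<open>The vertex \<open>z\<close> at depth \<open>d y x\<close> on a geodesic from
  \<open>y\<close> to \<open>x'\<close> is also between \<open>y\<close> and \<open>v\<close>, and
  so is \<open>x\<close> at the same depth; by uniqueness they agree.\<close>

lemma tree_ancestors_comparable:
  assumes V: "x \<in> V" "x' \<in> V" "y \<in> V" "v \<in> V"
    and x: "d y v = d y x + d x v" "d y v = d y x' + d x' v" and le: "d y x \<le> d y x'"
  shows "d y x + d x x' = d y x'"
proof -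
  obtain p where p: "geod p y x'" using ex_geod V by blast
  define z where "z = p ! d y x"
  have i: "d y x < length p" using p le by (simp add: geod_def)
  have zV: "z \<in> V" using i p unfolding z_def by (auto simp: geod_def walk_def)
  have z: "d y z = d y x" "d y z + d z x' = d y x'"
    using geod_split(1)[OF p i] geod_set[OF p nth_mem[OF i]] unfolding z_def by simp_all
  have "d z v \<le> d z x' + d x' v" "d y v \<le> d y z + d z v" using dist_triangle V zV by blast+
  then have "d y z + d z v = d y v" using z x by linarith
  then have "z = x" using tree_between_unique[OF V(3,4) zV V(1) _ x(1)[symmetric] z(1)] by blast
  then show ?thesis using z by simp
qed

text \<open>If two members of X were assigned the same leaf, one would lie between \<open>y\<close>
  and the other. The bound \<open>2 \<le> card X\<close> supplies \<open>x0\<close>, from which the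
  additional leaf \<open>v0\<close> is found beyond \<open>y\<close>.\<close>

lemma tree_mv_card:
  assumes X: "mv X" "2 \<le> card X"
  shows "card X \<le> card (leaves G)"
proof -
  have fin: "finite X" using mv_finite X by blast
  have XV: "x \<in> V" if "x \<in> X" for x using that X by (auto simp: mutual_visibility_set_def)
  obtain y where y: "y \<in> X" using X by fastforce
  have "\<not> X \<subseteq> {y}"
  proof
    assume "X \<subseteq> {y}"
    then have "card X \<le> card {y}" by (intro card_mono) auto
    then show False using X by simp
  qed
  then obtain x0 where x0: "x0 \<in> X" "x0 \<noteq> y" by blast
  have "\<forall>x\<in>X - {y}. \<exists>v. v \<in> leaves G \<and> d y v = d y x + d x v"
    using tree_leaf_beyond XV y by blast
  then obtain f where f: "\<And>x. x \<in> X - {y} \<Longrightarrow> f x \<in> leaves G \<and> d y (f x) = d y x + d x (f x)"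
    by metis
  obtain v0 where v0: "v0 \<in> leaves G" "d x0 v0 = d x0 y + d y v0"
    using tree_leaf_beyond[of y x0] XV y x0 by metis
  have LV: "v \<in> V" if "v \<in> leaves G" for v using that by (simp add: leaves_def)
  have inj: "inj_on f (X - {y})"
  proof (rule inj_onI)
    have main: "x = x'" if x: "x \<in> X - {y}" "x' \<in> X - {y}" "f x = f x'" "d y x \<le> d y x'" for x x'
    proof -
      have "d y x + d x x' = d y x'"
        using tree_ancestors_comparable[of x x' y "f x"] f[OF x(1)] f[OF x(2)] XV LV x y by simp
      then show ?thesis using tree_mv_between[OF X(1) y, of x' x] x by auto
    qed
    fix x x' assume "x \<in> X - {y}" "x' \<in> X - {y}" "f x = f x'"
    then show "x = x'" using main[of x x'] main[of x' x] by (cases "d y x \<le> d y x'") auto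
  qed
  \<comment> \<open>If \<open>v0\<close> were also beyond \<open>x\<close> as seen from
    \<open>y\<close>, the lengths would add up so that \<open>y\<close> lies between
    \<open>x0\<close> and \<open>x\<close>.\<close>
  have v0f: "v0 \<noteq> f x" if x: "x \<in> X - {y}" for x
  proof
    assume "v0 = f x"
    then have e: "d x0 v0 = d x0 y + (d y x + d x v0)" using f[OF x] v0 by simp
    have V: "x0 \<in> V" "x \<in> V" "y \<in> V" "v0 \<in> V" using x x0 y XV LV v0 by auto
    have "d x0 v0 \<le> d x0 x + d x v0" "d x0 x \<le> d x0 y + d y x" using dist_triangle V by blast+
    then have "d x0 y + d y x = d x0 x" using e by linarith
    then have "y = x0 \<or> y = x" using tree_mv_between[OF X(1) x0(1) _ y] x by blast
    then show False using x x0 by blast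
  qed
  have "card X = Suc (card (X - {y}))" by (rule card.remove[OF fin y])
  also have "\<dots> = Suc (card (f ` (X - {y})))" using inj by (simp add: card_image)
  also have "\<dots> = card (insert v0 (f ` (X - {y})))" using fin v0f by (subst card_insert_disjoint) auto
  also have "\<dots> \<le> card (leaves G)"
    using f v0 finite_V by (intro card_mono) (auto simp: leaves_def)
  finally show ?thesis .
qed

lemma tree_mv_number_iff: "mutual_visibility_number G = 3 \<longleftrightarrow> card (leaves G) = 3"
proof -
  obtain X where X: "mv X" "card X = mutual_visibility_number G" using ex_mv_number by blast
  then show ?thesis using tree_mv_card[OF X(1)] card_mv_le[OF mv_leaves] by linarith
qed

end

end

section \<open>Frog graphs\<close>

lemma set_vwalk_arcs: "set (vwalk_arcs p) = {(p ! i, p ! Suc i) | i. Suc i < length p}"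
proof (induction p rule: vwalk_arcs.induct)
  case (3 x y xs)
  have "{((x # y # xs) ! i, (x # y # xs) ! Suc i) | i. Suc i < length (x # y # xs)}
    = insert (x, y) {((y # xs) ! i, (y # xs) ! Suc i) | i. Suc i < length (y # xs)}" (is "?L = ?R")
  proof (intro equalityI subsetI)
    fix z assume "z \<in> ?L"
    then obtain i where "z = ((x # y # xs) ! i, (x # y # xs) ! Suc i)" "Suc i < length (x # y # xs)" by blast
    then show "z \<in> ?R" by (cases i) auto
  next
    fix z assume "z \<in> ?R"
    then consider "z = (x, y)" | i where "z = ((y # xs) ! i, (y # xs) ! Suc i)" "Suc i < length (y # xs)" by blast
    then show "z \<in> ?L"
    proof cases
      case 1
      then show ?thesis by (intro CollectI exI[of _ 0]) auto
    next
      case 2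
      then show ?thesis by (intro CollectI exI[of _ "Suc i"]) auto
    qed
  qed
  then show ?case using 3 by simp
qed auto

definition path_adj :: "'a list \<Rightarrow> 'a \<Rightarrow> 'a \<Rightarrow> bool" where
  "path_adj p x y \<longleftrightarrow> (\<exists>i. Suc i < length p \<and> (x = p ! i \<and> y = p ! Suc i \<or> x = p ! Suc i \<and> y = p ! i))"

lemma path_adj_set: "path_adj p x y \<Longrightarrow> x \<in> set p" "path_adj p x y \<Longrightarrow> y \<in> set p"
  by (auto simp: path_adj_def)

lemma parcs_path_graph:
  "(x, y) \<in> parcs (path_graph p) \<longleftrightarrow> path_adj p x y"
  by (auto simp: path_graph_def symcl_def set_vwalk_arcs path_adj_def)

text \<open>Indices range over all integers, so the closing edge looks like every other
  edge.\<close>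

lemma parcs_cycle_graph:
  assumes "xs \<noteq> []"
  shows "(x, y) \<in> parcs (cycle_graph xs) \<longleftrightarrow>
    (\<exists>i. x = cyc_fun xs i \<and> y = cyc_fun xs (i + 1) \<or> x = cyc_fun xs (i + 1) \<and> y = cyc_fun xs i)"
proof -
  have step: "(xs @ [hd xs]) ! i = cyc_fun xs (int i) \<and> (xs @ [hd xs]) ! Suc i = cyc_fun xs (int i + 1)"
    if i: "i < length xs" for i
  proof (cases "Suc i = length xs")
    case True
    then have "(int i + 1) mod int (length xs) = 0" by (metis mod_self of_nat_Suc add.commute)
    then show ?thesis using True i assms by (simp add: cyc_fun_nth nth_append cyc_fun_def hd_conv_nth)
  next
    case False
    then have "cyc_fun xs (int (Suc i)) = xs ! Suc i" using i by (intro cyc_fun_nth) simp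
    then show ?thesis using False i by (simp add: cyc_fun_nth nth_append add.commute)
  qed
  have "set (vwalk_arcs (xs @ [hd xs])) = {(cyc_fun xs i, cyc_fun xs (i + 1)) | i. True}"
    (is "?L = ?R")
  proof (intro equalityI subsetI)
    fix z assume "z \<in> ?L"
    then obtain i where "i < length xs" "z = ((xs @ [hd xs]) ! i, (xs @ [hd xs]) ! Suc i)"
      unfolding set_vwalk_arcs by auto
    then show "z \<in> ?R" using step[of i] by auto
  next
    fix z assume "z \<in> ?R"
    then obtain i where z: "z = (cyc_fun xs i, cyc_fun xs (i + 1))" by blast
    define m where "m = nat (i mod int (length xs))"
    have m: "int m = i mod int (length xs)" "m < length xs"
      using assms by (simp_all add: m_def nat_less_iff)
    have "cyc_fun xs (int m) = cyc_fun xs i" using m cyc_fun_mod by metis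
    moreover have "cyc_fun xs (int m + 1) = cyc_fun xs (i + 1)"
      by (simp add: m(1) cyc_fun_def mod_add_left_eq)
    ultimately have "z = ((xs @ [hd xs]) ! m, (xs @ [hd xs]) ! Suc m)" using z step[OF m(2)] by simp
    then show "z \<in> ?L" using m unfolding set_vwalk_arcs by auto
  qed
  then show ?thesis by (auto simp: cycle_graph_def symcl_def)
qed

section \<open>Retractions onto a cycle\<close>

context conn_graph
begin

lemma cyc_dist_upper:
  assumes "cyc n c"
  shows "int (d (c i) (c j)) \<le> cyc_dist n (i - j)"
proof -
  have n: "0 < n" using assms by (simp add: cyc_def)
  obtain k where k: "int k = cyc_dist n (i - j)"
    using cyc_dist_nonneg[OF n] nonneg_int_cases by metis
  have "c i = c (j + int k) \<or> c j = c (i + int k)"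
    using cyc_dist_cases[OF n, of "i - j"] k unfolding cyc_eq_iff[OF assms]
    by (simp add: dvd_diff_commute[of _ j] algebra_simps)
  then have "d (c i) (c j) \<le> k"
    using cyc_walk_dist[OF assms, of i k] cyc_walk_dist[OF assms, of j k]
      dist_sym[OF cyc_V[OF assms] cyc_V[OF assms], of i j] by auto
  then show ?thesis using k by linarith
qed

text \<open>\<open>pos\<close> maps vertices to residues modulo \<open>n\<close> so that each edge
  moves by at most one step. The cyclic distance to a fixed position is then 1-Lipschitz, and
  \<open>dist_lipschitz\<close> applies.\<close>

lemma retract_dist_ge:
  assumes n: "0 < n"
    and edge: "\<And>x y. adj x y \<Longrightarrow> int n dvd pos x - pos y \<or> int n dvd pos x - pos y - 1 \<or> int n dvd pos x - pos y + 1"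
    and V: "x \<in> V" "y \<in> V"
  shows "cyc_dist n (pos x - pos y) \<le> int (d x y)"
proof -
  let ?f = "\<lambda>z. cyc_dist n (pos z - pos y)"
  have "\<bar>?f u - ?f v\<bar> \<le> 1" if "adj u v" for u v
  proof -
    have C: "cyc_dist n a = cyc_dist n b" if "int n dvd a - b" for a b
      using that by (intro cyc_dist_cong) (simp add: mod_eq_dvd_iff)
    from edge[OF that] show ?thesis
    proof (elim disjE)
      assume "int n dvd pos u - pos v"
      then have "?f u = ?f v" by (intro C) simp
      then show ?thesis by simp
    next
      assume "int n dvd pos u - pos v - 1"
      then have "?f u = cyc_dist n (pos v - pos y + 1)" by (intro C) (simp add: algebra_simps)
      then show ?thesis using cyc_dist_succ[OF n, of "pos v - pos y"] by simp
    next
      assume "int n dvd pos u - pos v + 1"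
      then have "?f v = cyc_dist n (pos u - pos y + 1)"
        by (intro C) (subst dvd_diff_commute, simp add: algebra_simps)
      then show ?thesis using cyc_dist_succ[OF n, of "pos u - pos y"] by simp
    qed
  qed
  then have "\<bar>?f x - ?f y\<bar> \<le> int (d x y)" using V by (intro dist_lipschitz) auto
  moreover have "?f y = 0" using n by (simp add: cyc_dist_0_iff)
  ultimately show ?thesis by simp
qed

text \<open>If \<open>pos\<close> fixes the cycle, the cycle is a retract and therefore isometric.
  This replaces minimality where the whole graph is given explicitly.\<close>

lemma retract_dist:
  assumes c: "cyc n c" and pos: "\<And>i. int n dvd pos (c i) - i"
    and edge: "\<And>x y. adj x y \<Longrightarrow> int n dvd pos x - pos y \<or> int n dvd pos x - pos y - 1 \<or> int n dvd pos x - pos y + 1"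
  shows "int (d (c i) (c j)) = cyc_dist n (i - j)"
proof -
  have n: "0 < n" using c by (simp add: cyc_def)
  have "int n dvd (pos (c i) - i) - (pos (c j) - j)" by (rule dvd_diff[OF pos pos])
  then have "cyc_dist n (pos (c i) - pos (c j)) = cyc_dist n (i - j)"
    by (intro cyc_dist_cong) (simp add: mod_eq_dvd_iff algebra_simps)
  moreover have "cyc_dist n (pos (c i) - pos (c j)) \<le> int (d (c i) (c j))"
    by (rule retract_dist_ge[OF n]) (use edge cyc_V[OF c] in auto)
  ultimately show ?thesis using cyc_dist_upper[OF c, of i j] by simp
qed

end

section \<open>Antipodality inside a cycle graph\<close>

lemma conn_graphI:
  assumes H: "pair_graph H" "triangle_free H" and ne: "pverts H \<noteq> {}"
    and walks: "\<And>x y. x \<in> pverts H \<Longrightarrow> y \<in> pverts H \<Longrightarrow> \<exists>p. vwalk p (with_proj H) \<and> hd p = x \<and> last p = y"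
  shows "conn_graph H"
proof (rule conn_graph.intro)
  interpret pair_graph H by fact
  have "symmetric (with_proj H)" using sym_arcs by simp
  then have "x \<rightarrow>\<^sup>*\<^bsub>mk_symmetric (with_proj H)\<^esub> y" if "x \<in> pverts H" "y \<in> pverts H" for x y
    using walks[OF that] reachable_mk_symmetric_eq reachable_vwalk_conv by blast
  then show "connected (with_proj H)"
    using ne by (auto simp: connected_def strongly_connected_def)
qed fact+

text \<open>The definition of a frog measures antipodality inside the cycle alone, so the cycle
  graph has to be an instance of the locale in its own right. Triangle-freeness is the reason for
  length at least 4.\<close>

lemma conn_graph_cycle_graph:
  assumes xs: "distinct xs" "4 \<le> length xs"
  shows "conn_graph (cycle_graph xs)"
proof -
  let ?H = "cycle_graph xs"
  let ?n = "int (length xs)"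
  have ne: "xs \<noteq> []" using xs by auto
  note arcs = parcs_cycle_graph[OF ne]
  note eq = cyc_fun_eq_iff[OF xs(1) ne]
  have V: "pverts ?H = range (cyc_fun xs)" using range_cyc_fun[OF ne] by (simp add: cycle_graph_def)
  have step: "\<not> ?n dvd k" if "0 < \<bar>k\<bar>" "\<bar>k\<bar> < 4" for k
    using that xs zdvd_not_zless[of "\<bar>k\<bar>" ?n] by auto
  have loop: "x \<noteq> y" if loop_arc: "(x, y) \<in> parcs ?H" for x y
  proof
    assume "x = y"
    then obtain i where "cyc_fun xs i = cyc_fun xs (i + 1)" using loop_arc unfolding arcs by metis
    then show False using step[of "-1"] by (simp add: eq)
  qed
  have sym: "(y, x) \<in> parcs ?H" if "(x, y) \<in> parcs ?H" for x y
    using that unfolding arcs by blast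
  have fin: "finite (pverts ?H)" by (simp add: cycle_graph_def)
  have sub: "parcs ?H \<subseteq> pverts ?H \<times> pverts ?H"
    using arcs unfolding V by auto
  have "pair_graph ?H"
  proof
    show "finite (parcs ?H)" using sub fin by (meson finite_SigmaI finite_subset)
    show "symmetric (with_proj ?H)"
      using sym by (auto simp: symmetric_def sym_def)
  qed (use sub loop fin in auto)
  moreover have "triangle_free ?H"
    unfolding triangle_free_def
  proof
    have *: "\<exists>i e. x = cyc_fun xs i \<and> y = cyc_fun xs (i + e) \<and> \<bar>e\<bar> = 1" if xy: "(x, y) \<in> parcs ?H" for x y
    proof -
      obtain i where "x = cyc_fun xs i \<and> y = cyc_fun xs (i + 1) \<or> x = cyc_fun xs (i + 1) \<and> y = cyc_fun xs i"
        using xy unfolding arcs by blast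
      then show ?thesis
      proof
        assume "x = cyc_fun xs i \<and> y = cyc_fun xs (i + 1)"
        then show ?thesis by (intro exI[of _ i] exI[of _ 1]) simp
      next
        assume "x = cyc_fun xs (i + 1) \<and> y = cyc_fun xs i"
        then show ?thesis by (intro exI[of _ "i + 1"] exI[of _ "-1"]) simp
      qed
    qed
    assume "\<exists>u v w. (u, v) \<in> parcs ?H \<and> (v, w) \<in> parcs ?H \<and> (w, u) \<in> parcs ?H"
    then obtain u v w where "(u, v) \<in> parcs ?H" "(v, w) \<in> parcs ?H" "(w, u) \<in> parcs ?H" by blast
    then obtain i e j f k g where
      "u = cyc_fun xs i" "v = cyc_fun xs (i + e)" "\<bar>e\<bar> = 1"
      "v = cyc_fun xs j" "w = cyc_fun xs (j + f)" "\<bar>f\<bar> = 1"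
      "w = cyc_fun xs k" "u = cyc_fun xs (k + g)" "\<bar>g\<bar> = 1" using * by meson
    then have "?n dvd (i + e - j)" "?n dvd (j + f - k)" "?n dvd (k + g - i)" and efg: "\<bar>e\<bar> = 1" "\<bar>f\<bar> = 1" "\<bar>g\<bar> = 1"
      using eq by metis+
    \<comment> \<open>The steps \<open>e\<close>, \<open>f\<close>, \<open>g\<close> are 1 or -1;
      their sum is odd with absolute value at most 3, so it is no multiple of a length that is at
      least 4.\<close>
    then have "?n dvd (i + e - j) + (j + f - k) + (k + g - i)" by (intro dvd_add)
    then have "?n dvd e + f + g" by (simp add: algebra_simps)
    then show False using step[of "e + f + g"] efg by linarith
  qed
  moreover have "pverts ?H \<noteq> {}" using V by simp
  moreover have "\<exists>p. vwalk p (with_proj ?H) \<and> hd p = x \<and> last p = y" if "x \<in> pverts ?H" "y \<in> pverts ?H" for x y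
  proof -
    obtain i j where ij: "x = cyc_fun xs i" "y = cyc_fun xs j" using \<open>x \<in> _\<close> \<open>y \<in> _\<close> V by auto
    define k where "k = nat ((j - i) mod ?n)"
    have "int k = (j - i) mod ?n" using ne by (simp add: k_def)
    then have "?n dvd (j - i) - int k" by (simp add: dvd_minus_mod)
    then have y: "y = cyc_fun xs (i + int k)" using ij eq by (simp add: algebra_simps)
    let ?p = "map (\<lambda>t. cyc_fun xs (i + int t)) [0..<Suc k]"
    have "set (vwalk_arcs ?p) \<subseteq> parcs ?H"
    proof
      fix z assume "z \<in> set (vwalk_arcs ?p)"
      then obtain t where "Suc t < length ?p" "z = (?p ! t, ?p ! Suc t)" unfolding set_vwalk_arcs by blast
      then have "z = (cyc_fun xs (i + int t), cyc_fun xs (i + int t + 1))"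
        by (simp add: algebra_simps del: upt_Suc)
      then show "z \<in> parcs ?H" using arcs by (cases z) blast
    qed
    then have "vwalk ?p (with_proj ?H)" unfolding vwalk_def V with_proj_simps by auto
    moreover have "hd ?p = x" using ij by (simp add: hd_map del: upt_Suc)
    moreover have "last ?p = y" using y by (simp add: last_map)
    ultimately show ?thesis by blast
  qed
  ultimately show ?thesis by (rule conn_graphI)
qed

lemma cycle_graph_dist:
  assumes xs: "distinct xs" "4 \<le> length xs"
  shows "int (graph_dist (cycle_graph xs) (cyc_fun xs i) (cyc_fun xs j)) = cyc_dist (length xs) (i - j)"
proof -
  interpret H: conn_graph "cycle_graph xs" by (rule conn_graph_cycle_graph[OF xs])
  have ne: "xs \<noteq> []" using xs by auto
  note eq = cyc_fun_eq_iff[OF xs(1) ne]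
  define pos where "pos x = (SOME i. cyc_fun xs i = x)" for x
  have "cyc_fun xs (pos (cyc_fun xs k)) = cyc_fun xs k" for k
    unfolding pos_def by (rule someI[where P = "\<lambda>i. cyc_fun xs i = cyc_fun xs k"]) simp
  then have pos: "int (length xs) dvd pos (cyc_fun xs k) - k" for k using eq by blast
  have adj: "H.adj x y \<longleftrightarrow> (\<exists>i. x = cyc_fun xs i \<and> y = cyc_fun xs (i + 1) \<or> x = cyc_fun xs (i + 1) \<and> y = cyc_fun xs i)" for x y
    unfolding H.adj_def by (rule parcs_cycle_graph[OF ne])
  have "H.cyc (length xs) (cyc_fun xs)"
    unfolding H.cyc_def using xs eq adj by auto
  moreover have "int (length xs) dvd pos x - pos y \<or> int (length xs) dvd pos x - pos y - 1 \<or> int (length xs) dvd pos x - pos y + 1"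
    if xy: "H.adj x y" for x y
  proof -
    obtain k where k: "x = cyc_fun xs k \<and> y = cyc_fun xs (k + 1) \<or> x = cyc_fun xs (k + 1) \<and> y = cyc_fun xs k"
      using xy adj by blast
    have "int (length xs) dvd (pos (cyc_fun xs k) - k) - (pos (cyc_fun xs (k + 1)) - (k + 1))"
      "int (length xs) dvd (pos (cyc_fun xs (k + 1)) - (k + 1)) - (pos (cyc_fun xs k) - k)"
      by (intro dvd_diff pos)+
    then show ?thesis using k by (auto simp: algebra_simps)
  qed
  ultimately show ?thesis by (rule H.retract_dist[OF _ pos])
qed

lemma antipodal_cycle_graph_iff:
  assumes xs: "distinct xs" "4 \<le> length xs"
  shows "antipodal (cycle_graph xs) (cyc_fun xs i) (cyc_fun xs j) \<longleftrightarrow>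
    cyc_dist (length xs) (i - j) = int (length xs) div 2"
proof -
  have ne: "xs \<noteq> []" using xs by auto
  have V: "pverts (cycle_graph xs) = range (cyc_fun xs)" "card (pverts (cycle_graph xs)) = length xs"
    using range_cyc_fun[OF ne] xs by (simp_all add: cycle_graph_def distinct_card)
  have "antipodal (cycle_graph xs) (cyc_fun xs i) (cyc_fun xs j) \<longleftrightarrow>
    int (graph_dist (cycle_graph xs) (cyc_fun xs i) (cyc_fun xs j)) = int (length xs div 2)"
    using V by (simp add: antipodal_def)
  then show ?thesis by (simp add: cycle_graph_dist[OF xs] zdiv_int)
qed

section \<open>Frog graphs in normal form\<close>

context conn_graph
begin

text \<open>The cycle is rotated so that \<open>p\<close> is attached at index 0 and
  \<open>q\<close> at index \<open>j\<close>. Exchanging the tails and reflecting the cycle preserve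
  this form, so it is enough to argue about \<open>p\<close> and about one of the two arcs.\<close>

definition frog_at :: "nat \<Rightarrow> (int \<Rightarrow> 'a) \<Rightarrow> 'a list \<Rightarrow> 'a list \<Rightarrow> int \<Rightarrow> bool" where
  "frog_at n c p q j \<longleftrightarrow> cyc n c \<and> p \<noteq> [] \<and> q \<noteq> [] \<and> distinct p \<and> distinct q \<and>
    hd p = c 0 \<and> hd q = c j \<and> set p \<inter> range c = {c 0} \<and> set q \<inter> range c = {c j} \<and>
    set p \<inter> set q = {} \<and> cyc_dist n j = int n div 2 \<and> V = range c \<union> set p \<union> set q \<and>
    (\<forall>x y. adj x y \<longleftrightarrow> (\<exists>i. x = c i \<and> y = c (i + 1) \<or> x = c (i + 1) \<and> y = c i) \<or>
      path_adj p x y \<or> path_adj q x y)"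

lemma frog_at_swap:
  assumes f: "frog_at n c p q j"
  shows "frog_at n (\<lambda>i. c (j + i)) q p (- j)"
proof -
  have r: "range (\<lambda>i. c (j + i)) = range c"
  proof
    show "range c \<subseteq> range (\<lambda>i. c (j + i))"
    proof
      fix x assume "x \<in> range c"
      then obtain i where "x = c (j + (i - j))" by auto
      then show "x \<in> range (\<lambda>i. c (j + i))" by blast
    qed
  qed auto
  have a: "(\<exists>i. x = c i \<and> y = c (i + 1) \<or> x = c (i + 1) \<and> y = c i) \<longleftrightarrow>
      (\<exists>i. x = c (j + i) \<and> y = c (j + (i + 1)) \<or> x = c (j + (i + 1)) \<and> y = c (j + i))" (is "?L \<longleftrightarrow> ?R") for x y
  proof
    assume ?L
    then obtain i where "x = c i \<and> y = c (i + 1) \<or> x = c (i + 1) \<and> y = c i" by blast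
    then show ?R by (intro exI[of _ "i - j"]) (simp add: algebra_simps)
  next
    assume ?R
    then show ?L by (metis add.assoc)
  qed
  show ?thesis
    using f unfolding frog_at_def r a by (auto simp: cyc_shift Int_commute Un_ac)
qed

lemma frog_at_rev:
  assumes f: "frog_at n c p q j"
  shows "frog_at n (\<lambda>i. c (- i)) p q (- j)"
proof -
  have r: "range (\<lambda>i. c (- i)) = range c"
  proof
    show "range c \<subseteq> range (\<lambda>i. c (- i))"
    proof
      fix x assume "x \<in> range c"
      then obtain i where "x = c (- (- i))" by auto
      then show "x \<in> range (\<lambda>i. c (- i))" by blast
    qed
  qed auto
  have a: "(\<exists>i. x = c i \<and> y = c (i + 1) \<or> x = c (i + 1) \<and> y = c i) \<longleftrightarrow>
      (\<exists>i. x = c (- i) \<and> y = c (- (i + 1)) \<or> x = c (- (i + 1)) \<and> y = c (- i))" (is "?L \<longleftrightarrow> ?R") for x y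
  proof
    assume ?L
    then obtain i where "x = c i \<and> y = c (i + 1) \<or> x = c (i + 1) \<and> y = c i" by blast
    then show ?R by (intro exI[of _ "- i - 1"]) (auto simp: algebra_simps)
  next
    assume ?R
    then obtain i where "x = c (- i) \<and> y = c (- (i + 1)) \<or> x = c (- (i + 1)) \<and> y = c (- i)" by blast
    then have "x = c (- i - 1) \<and> y = c ((- i - 1) + 1) \<or> x = c ((- i - 1) + 1) \<and> y = c (- i - 1)" by auto
    then show ?L by blast
  qed
  have "cyc n (\<lambda>i. c (- i))" if "cyc n c" using cyc_rev[OF that, of 0] by simp
  then show ?thesis
    using f unfolding frog_at_def r a by (auto simp: Int_commute Un_ac)
qed

lemma walk_crosses:
  assumes "walk g" "hd g \<in> S" "last g \<notin> S" "\<And>x y. x \<in> S \<Longrightarrow> y \<notin> S \<Longrightarrow> adj x y \<Longrightarrow> y \<in> B"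
  shows "\<exists>z\<in>set g. z \<in> B"
  using assms(1-3)
proof (induction g)
  case (Cons x g)
  show ?case
  proof (cases "g = []")
    case False
    then have "adj x (hd g)" "walk g" using Cons.prems by (auto simp: walk_Cons)
    then show ?thesis using Cons False assms(4)[of x "hd g"] hd_in_set[OF False] by (cases "hd g \<in> S") auto
  qed (use Cons.prems in auto)
qed (simp add: walk_def)

text \<open>Every walk leaving \<open>S\<close> meets \<open>B\<close>, hence a point of X other
  than its two ends. All blocking arguments for frogs, except the final one by antipodality, use
  this form.\<close>

lemma mv_not_separated:
  assumes X: "mv X" and xy: "x \<in> X" "y \<in> X" "x \<in> S" "y \<notin> S"
    and cut: "\<And>u v. u \<in> S \<Longrightarrow> v \<notin> S \<Longrightarrow> adj u v \<Longrightarrow> v \<in> B"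
    and B: "B \<subseteq> X" "x \<notin> B" "y \<notin> B"
  shows False
proof -
  have "x \<noteq> y" using xy by auto
  then obtain g where g: "geod g x y" "set g \<inter> X = {x, y}" using mv_geod[OF X xy(1,2)] by blast
  then obtain z where "z \<in> set g" "z \<in> B"
    using walk_crosses[of g S B] xy cut by (auto simp: geod_def)
  then show False using g B by auto
qed

section \<open>Cuts and positions in a frog\<close>

context
  fixes n c p q j
  assumes frog: "frog_at n c p q j"
begin

lemma frog_cyc: "cyc n c" using frog by (simp add: frog_at_def)

lemma frog_n: "4 \<le> n" using cyc_ge_4[OF frog_cyc] .

lemma frog_adj: "adj x y \<longleftrightarrow> (\<exists>i. x = c i \<and> y = c (i + 1) \<or> x = c (i + 1) \<and> y = c i) \<or>
      path_adj p x y \<or> path_adj q x y"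
  using frog by (simp add: frog_at_def)

lemma frog_V: "V = range c \<union> set p \<union> set q" using frog by (simp add: frog_at_def)

lemma frog_hd: "hd p = c 0" "hd q = c j" "p ! 0 = c 0" "p \<noteq> []"
  using frog by (auto simp: frog_at_def hd_conv_nth)

lemma frog_Int: "set p \<inter> range c = {c 0}" "set q \<inter> range c = {c j}" "set p \<inter> set q = {}"
  using frog by (auto simp: frog_at_def)

lemma frog_nth_eq: "a < length p \<Longrightarrow> b < length p \<Longrightarrow> p ! a = p ! b \<longleftrightarrow> a = b"
  using frog by (simp add: frog_at_def nth_eq_iff_index_eq)

text \<open>The part of the tail strictly beyond \<open>p ! m\<close> is attached to the rest only
  through \<open>p ! m\<close>.\<close>

lemma frog_tail_cut:
  assumes m: "m < length p" and u: "u \<in> {p ! t | t. m < t \<and> t < length p}"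
    and v: "v \<notin> {p ! t | t. m < t \<and> t < length p}" and uv: "adj u v"
  shows "v = p ! m"
proof -
  obtain t where t: "u = p ! t" "m < t" "t < length p" using u by auto
  then have up: "u \<in> set p" by simp
  have "0 < length p" using t by linarith
  then have "u \<noteq> c 0" using frog_nth_eq[of t 0] t frog_hd(3) by simp
  then have "u \<notin> range c" using up frog_Int(1) by blast
  moreover have "u \<notin> set q" using up frog_Int(3) by blast
  ultimately have "path_adj p u v" using uv unfolding frog_adj by (metis path_adj_set(1) rangeI)
  then obtain i where i: "Suc i < length p" "u = p ! i \<and> v = p ! Suc i \<or> u = p ! Suc i \<and> v = p ! i"
    by (auto simp: path_adj_def)
  from i(2) show ?thesis
  proof
    assume *: "u = p ! i \<and> v = p ! Suc i"
    then have "t = i" using t i frog_nth_eq by simp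
    then show ?thesis using v * t i by auto
  next
    assume *: "u = p ! Suc i \<and> v = p ! i"
    then have "t = Suc i" using t i frog_nth_eq by simp
    moreover have "\<not> m < i" using v * i by auto
    ultimately have "i = m" using t by simp
    then show ?thesis using * by simp
  qed
qed

lemma frog_tail_block:
  assumes X: "mv X" and m: "m < e" "e < length p" "p ! m \<in> X" "p ! e \<in> X"
    and z: "z \<in> X" "z \<noteq> p ! m" "z \<notin> {p ! t | t. m < t \<and> t < length p}"
  shows False
proof (rule mv_not_separated[OF X m(4) z(1)])
  show "p ! e \<in> {p ! t | t. m < t \<and> t < length p}" using m by auto
  show "z \<notin> {p ! t | t. m < t \<and> t < length p}" by fact
  show "v \<in> {p ! m}" if "u \<in> {p ! t | t. m < t \<and> t < length p}" "v \<notin> {p ! t | t. m < t \<and> t < length p}" "adj u v" for u v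
    using frog_tail_cut[of m u v] that m by auto
  show "p ! e \<notin> {p ! m}" using m frog_nth_eq[of e m] by simp
qed (use m z in auto)

text \<open>Let \<open>p ! a\<close>, \<open>p ! b\<close> with \<open>a < b\<close> be in X, and
  \<open>z\<close> a third point. If \<open>z\<close> is not beyond \<open>p ! a\<close>, then
  \<open>p ! a\<close> hides \<open>p ! b\<close> from it. Otherwise the nearer of \<open>z\<close>
  and \<open>p ! b\<close> hides the farther one from \<open>p ! a\<close>.\<close>

lemma frog_tail_one:
  assumes X: "mv X" "3 \<le> card X" and xy: "x \<in> X" "y \<in> X" "x \<in> set p" "y \<in> set p"
  shows "x = y"
proof -
  have main: False if ab: "a < b" "b < length p" "p ! a \<in> X" "p ! b \<in> X" for a b
  proof -
    have "\<not> X \<subseteq> {p ! a, p ! b}"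
    proof
      assume "X \<subseteq> {p ! a, p ! b}"
      then have "card X \<le> card {p ! a, p ! b}" by (intro card_mono) auto
      also have "\<dots> \<le> 2" by (simp add: card_insert_le_m1)
      finally show False using X by simp
    qed
    then obtain z where z: "z \<in> X" "z \<noteq> p ! a" "z \<noteq> p ! b" by auto
    show False
    proof (cases "z \<in> {p ! t | t. a < t \<and> t < length p}")
      case False
      then show ?thesis using frog_tail_block[OF X(1) ab] z by blast
    next
      case True
      then obtain e where e: "z = p ! e" "a < e" "e < length p" by auto
      then have "e \<noteq> b" using z by auto
      have "p ! a \<notin> {p ! t | t. s < t \<and> t < length p}" if "a < s" for s
      proof
        assume "p ! a \<in> {p ! t | t. s < t \<and> t < length p}"
        then obtain t where "p ! a = p ! t" "s < t" "t < length p" by blast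
        then show False using frog_nth_eq[of a t] ab that by simp
      qed
      moreover have "p ! a \<noteq> p ! s" if "a < s" "s < length p" for s
        using frog_nth_eq[of a s] ab that by auto
      ultimately have "p ! a \<noteq> p ! s" "p ! a \<notin> {p ! t | t. s < t \<and> t < length p}" if "s = b \<or> s = e" for s
        using that ab e by auto
      then show ?thesis
        using frog_tail_block[OF X(1), of b e "p ! a"] frog_tail_block[OF X(1), of e b "p ! a"] \<open>e \<noteq> b\<close> e ab z(1)
        by (cases "b < e") auto
    qed
  qed
  obtain a b where "x = p ! a" "a < length p" "y = p ! b" "b < length p"
    using xy by (auto simp: in_set_conv_nth)
  then show ?thesis using main[of a b] main[of b a] xy by (cases a b rule: linorder_cases) auto
qed

text \<open>The retraction that collapses each tail to its attachment vertex. The chosen index is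
  determined only modulo \<open>n\<close>, so statements about positions are divisibilities.\<close>

definition frog_pos :: "'a \<Rightarrow> int" where
  "frog_pos x = (if x \<in> range c then (SOME i. c i = x) else if x \<in> set p then 0 else j)"

lemma c_frog_pos: "x \<in> range c \<Longrightarrow> c (frog_pos x) = x"
proof -
  assume x: "x \<in> range c"
  then have "\<exists>i. c i = x" by auto
  then have "c (SOME i. c i = x) = x" by (rule someI_ex)
  then show ?thesis using x by (simp add: frog_pos_def)
qed

lemma frog_pos_c: "int n dvd frog_pos (c i) - i"
  using c_frog_pos[OF rangeI, of i] cyc_eq_iff[OF frog_cyc] by simp

lemma frog_pos_p: "x \<in> set p \<Longrightarrow> int n dvd frog_pos x"
proof (cases "x \<in> range c")
  case True
  assume "x \<in> set p"
  then have "x = c 0" using True frog_Int(1) by auto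
  then show ?thesis using frog_pos_c[of 0] by simp
qed (simp add: frog_pos_def)

lemma frog_pos_q: "x \<in> set q \<Longrightarrow> int n dvd frog_pos x - j"
proof (cases "x \<in> range c")
  case True
  assume "x \<in> set q"
  then have "x = c j" using True frog_Int(2) by auto
  then show ?thesis using frog_pos_c[of j] by simp
next
  case False
  assume "x \<in> set q"
  then have "x \<notin> set p" using frog_Int(3) by auto
  then show ?thesis using False by (simp add: frog_pos_def)
qed

text \<open>An edge that changes the position is a cycle edge. Recording
  \<open>y \<in> range c\<close> in that case is what pins down the exits in
  \<open>frog_arc_cut\<close>.\<close>

lemma frog_pos_edge:
  assumes "adj x y"
  shows "int n dvd frog_pos y - frog_pos x \<or>
    y \<in> range c \<and> (int n dvd frog_pos y - frog_pos x - 1 \<or> int n dvd frog_pos y - frog_pos x + 1)"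
proof -
  consider i where "x = c i" "y = c (i + 1)" | i where "x = c (i + 1)" "y = c i" | "path_adj p x y" | "path_adj q x y"
    using assms frog_adj by blast
  then show ?thesis
  proof cases
    case (1 i)
    have "int n dvd (frog_pos (c (i + 1)) - (i + 1)) - (frog_pos (c i) - i)"
      by (rule dvd_diff[OF frog_pos_c frog_pos_c])
    then show ?thesis using 1 by (simp add: algebra_simps)
  next
    case (2 i)
    have "int n dvd (frog_pos (c i) - i) - (frog_pos (c (i + 1)) - (i + 1))"
      by (rule dvd_diff[OF frog_pos_c frog_pos_c])
    then show ?thesis using 2 by (simp add: algebra_simps)
  next
    case 3
    then show ?thesis using path_adj_set[OF 3] frog_pos_p by (simp add: dvd_diff)
  next
    case 4
    then have "int n dvd (frog_pos y - j) - (frog_pos x - j)"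
      using path_adj_set[OF 4] frog_pos_q dvd_diff by blast
    then show ?thesis by simp
  qed
qed

lemma frog_dist: "int (d (c i) (c k)) = cyc_dist n (i - k)"
proof (rule retract_dist[OF frog_cyc, of frog_pos])
  fix x y assume "adj x y"
  then show "int n dvd frog_pos x - frog_pos y \<or> int n dvd frog_pos x - frog_pos y - 1 \<or> int n dvd frog_pos x - frog_pos y + 1"
    using frog_pos_edge[OF adj_sym] by blast
qed (rule frog_pos_c)

text \<open>Points with the same position are equal cycle vertices or belong to the same tail,
  attachment vertex included. For \<open>q\<close> the one-point property is assumed as
  \<open>qone\<close>; it is supplied later by exchanging the tails.\<close>

lemma frog_pos_inj:
  assumes X: "mv X" "3 \<le> card X" and qone: "\<And>x y. x \<in> X \<Longrightarrow> y \<in> X \<Longrightarrow> x \<in> set q \<Longrightarrow> y \<in> set q \<Longrightarrow> x = y"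
    and xy: "x \<in> X" "y \<in> X" and eq: "int n dvd frog_pos x - frog_pos y"
  shows "x = y"
proof -
  have V: "x \<in> V" "y \<in> V" using X xy by (auto simp: mutual_visibility_set_def)
  have c0: "z \<in> set p" if "z \<in> range c" "int n dvd frog_pos z" for z
  proof -
    have "z = c 0" using cyc_eq_iff[OF frog_cyc, of "frog_pos z" 0] c_frog_pos that by simp
    then show ?thesis using frog_Int(1) by auto
  qed
  have cj: "z \<in> set q" if "z \<in> range c" "int n dvd frog_pos z - j" for z
  proof -
    have "z = c j" using cyc_eq_iff[OF frog_cyc, of "frog_pos z" j] c_frog_pos that by simp
    then show ?thesis using frog_Int(2) by auto
  qed
  have nj: "\<not> int n dvd j"
  proof
    assume "int n dvd j"
    then have "c j = c 0" using cyc_eq_iff[OF frog_cyc] by simp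
    then show False using frog_Int by auto
  qed
  have pq: False if "int n dvd a" "int n dvd b - j" "int n dvd a - b" for a b
  proof -
    have "int n dvd a - (b - j) - (a - b)" using that by (meson dvd_diff)
    then show False using nj by simp
  qed
  have eq': "int n dvd frog_pos y - frog_pos x" using eq by (simp add: dvd_diff_commute)
  have tr: "int n dvd a - e" if "int n dvd b - e" "int n dvd a - b" for a b e
    using dvd_add[OF that] by simp
  have P: "x = y" if "x \<in> set p" "y \<in> set p" using frog_tail_one[OF X xy that] .
  consider "x \<in> range c" "y \<in> range c" | "x \<in> set p" | "y \<in> set p" | "x \<in> set q" | "y \<in> set q"
    using V frog_V by auto
  then show ?thesis
  proof cases
    case 1
    then show ?thesis using cyc_eq_iff[OF frog_cyc, of "frog_pos x" "frog_pos y"] c_frog_pos eq by simp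
  next
    case 2
    then have "int n dvd frog_pos y" using tr[of "frog_pos x" 0 "frog_pos y"] eq' frog_pos_p by simp
    moreover have "y \<notin> set q" using pq[of "frog_pos x" "frog_pos y"] 2 eq frog_pos_p frog_pos_q by blast
    ultimately show ?thesis using P 2 c0[of y] V frog_V by auto
  next
    case 3
    then have "int n dvd frog_pos x" using tr[of "frog_pos y" 0 "frog_pos x"] eq frog_pos_p by simp
    moreover have "x \<notin> set q" using pq[of "frog_pos y" "frog_pos x"] 3 eq' frog_pos_p frog_pos_q by blast
    ultimately show ?thesis using P 3 c0[of x] V frog_V by auto
  next
    case 4
    then have "int n dvd frog_pos y - j" using tr[of "frog_pos x" j "frog_pos y"] eq' frog_pos_q by simp
    moreover have "y \<notin> set p" using pq[of "frog_pos y" "frog_pos x"] 4 eq' frog_pos_p frog_pos_q by blast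
    ultimately show ?thesis using qone[OF xy] 4 cj[of y] V frog_V by auto
  next
    case 5
    then have "int n dvd frog_pos x - j" using tr[of "frog_pos y" j "frog_pos x"] eq frog_pos_q by simp
    moreover have "x \<notin> set p" using pq[of "frog_pos x" "frog_pos y"] 5 eq frog_pos_p frog_pos_q by blast
    ultimately show ?thesis using qone[OF xy] 5 cj[of x] V frog_V by auto
  qed
qed

text \<open>The set consists of everything positioned strictly inside the arc, including a tail
  hanging there. Leaving it changes the position, so it happens along the cycle and at an end of the
  arc.\<close>

lemma frog_arc_cut:
  assumes ab: "\<alpha> < \<beta>" "u \<in> {z. \<exists>m. \<alpha> < m \<and> m < \<beta> \<and> int n dvd frog_pos z - m}"
    and v: "v \<notin> {z. \<exists>m. \<alpha> < m \<and> m < \<beta> \<and> int n dvd frog_pos z - m}" and uv: "adj u v"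
  shows "v = c \<alpha> \<or> v = c \<beta>"
proof -
  obtain m where m: "\<alpha> < m" "m < \<beta>" "int n dvd frog_pos u - m" using ab by auto
  have tr: "int n dvd a - e" if "int n dvd b - e" "int n dvd a - b" for a b e
    using dvd_add[OF that] by simp
  have v': "\<not> int n dvd frog_pos v - k" if "\<alpha> < k" "k < \<beta>" for k using v that by blast
  have cv: "v = c k" if "v \<in> range c" "int n dvd frog_pos v - k" for k
    using cyc_eq_iff[OF frog_cyc, of "frog_pos v" k] c_frog_pos that by simp
  from frog_pos_edge[OF uv] show ?thesis
  proof (elim disjE conjE)
    assume "int n dvd frog_pos v - frog_pos u"
    then have "int n dvd frog_pos v - m" using tr m by blast
    then show ?thesis using v' m by blast
  next
    assume v: "v \<in> range c" and "int n dvd frog_pos v - frog_pos u - 1"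
    then have "int n dvd (frog_pos v - frog_pos u - 1) + (frog_pos u - m)" using m dvd_add by blast
    then have *: "int n dvd frog_pos v - (m + 1)" by (simp add: algebra_simps)
    then have "m + 1 = \<beta>" using v'[of "m + 1"] m by force
    then show ?thesis using cv[OF v *] by simp
  next
    assume v: "v \<in> range c" and "int n dvd frog_pos v - frog_pos u + 1"
    then have "int n dvd (frog_pos v - frog_pos u + 1) + (frog_pos u - m)" using m dvd_add by blast
    then have *: "int n dvd frog_pos v - (m - 1)" by (simp add: algebra_simps)
    then have "m - 1 = \<alpha>" using v'[of "m - 1"] m by force
    then show ?thesis using cv[OF v *] by simp
  qed
qed

end

end

lemma four_ints:
  fixes F :: "int set"
  assumes "finite F" "4 \<le> card F"
  obtains a b e f where "a \<in> F" "b \<in> F" "e \<in> F" "f \<in> F" "a < b" "b < e" "e < f"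
proof -
  let ?l = "sorted_list_of_set F"
  have l: "4 \<le> length ?l" using assms by simp
  have lt: "?l ! i < ?l ! k" if "i < k" "k < 4" for i k
    using strict_sorted_list_of_set[of F] that l by (auto simp: sorted_wrt_iff_nth_less)
  have mem: "?l ! i \<in> F" if "i < 4" for i
    using nth_mem[of i ?l] that l assms by simp
  show ?thesis
    using that[of "?l ! 0" "?l ! 1" "?l ! 2" "?l ! 3"] lt mem by simp
qed

section \<open>The maximum size of visible sets in a frog\<close>

context conn_graph
begin

lemma frog_at_mod:
  assumes f: "frog_at n c p q j"
  shows "frog_at n c p q (j mod int n)"
proof -
  have "c (j mod int n) = c j"
    using f by (subst cyc_eq_iff[of n c]) (auto simp: frog_at_def mod_eq_dvd_iff[symmetric])
  then show ?thesis using f unfolding frog_at_def by (simp add: cyc_dist_mod)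
qed

lemma frog_gate:
  assumes f: "frog_at n c p q j" and x: "x \<in> set p" and y: "y \<in> V" "y \<notin> set p"
  shows "d x y = d x (c 0) + d (c 0) y"
proof (cases "x = c 0")
  case True
  then show ?thesis using cyc_V[OF frog_cyc[OF f]] by simp
next
  case False
  let ?S = "{p ! t | t. 0 < t \<and> t < length p}"
  have xV: "x \<in> V" using x frog_V[OF f] by simp
  then obtain g where g: "geod g x y" using ex_geod y by blast
  obtain t where t: "t < length p" "x = p ! t" using x by (auto simp: in_set_conv_nth)
  have "t \<noteq> 0" using False t frog_hd(3)[OF f] by metis
  then have "x \<in> ?S" using t by auto
  moreover have "y \<notin> ?S" using y by auto
  moreover have "v \<in> {c 0}" if "u \<in> ?S" "v \<notin> ?S" "adj u v" for u v
    using frog_tail_cut[OF f, of 0 u v] that frog_hd(3,4)[OF f] by auto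
  ultimately obtain z where "z \<in> set g" "z \<in> {c 0}"
    using walk_crosses[of g ?S "{c 0}"] g by (auto simp: geod_def)
  then show ?thesis using geod_set[OF g] by simp
qed

text \<open>A geodesic from \<open>c t\<close> to \<open>x\<close> may not use \<open>c s\<close>,
  so it runs through \<open>c j\<close>. Cancelling the common part of the tail yields
  \<open>d (c t) (c j) + d (c 0) (c j) \<le> d (c t) (c 0)\<close>. But \<open>c 0\<close> and
  \<open>c j\<close> already realise the largest distance on the cycle, and \<open>c t\<close>
  differs from \<open>c j\<close>.\<close>

lemma frog_arc_pair:
  assumes f: "frog_at n c p q j" and X: "mv X"
    and st: "0 < s" "s < t" "t < j" "j < int n"
    and mem: "x \<in> X" "x \<in> set p" "c s \<in> X" "c t \<in> X"
  shows False
proof -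
  note c = frog_cyc[OF f]
  have n: "0 < n" using frog_n[OF f] by simp
  let ?S = "{z. \<exists>m. s < m \<and> m < j \<and> int n dvd frog_pos c p j z - m}"
  have xr: "x = c 0" if "x \<in> range c" using that mem frog_Int(1)[OF f] by auto
  have c0: "c r \<noteq> c 0" if "0 < r" "r < int n" for r using cyc_neq[OF c, of r 0] that by simp
  have xt: "x \<noteq> c t" "x \<noteq> c s" using xr c0[of t] c0[of s] st by auto
  have st': "c s \<noteq> c t" using st by (intro cyc_neq[OF c]) auto
  obtain g where g: "geod g (c t) x" "set g \<inter> X = {c t, x}"
    using mv_geod[OF X mem(4,1) xt(1)[symmetric]] .
  have "c t \<in> ?S" using frog_pos_c[OF f, of t] st by auto
  moreover have "x \<notin> ?S"
  proof
    assume "x \<in> ?S"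
    then obtain m where m: "s < m" "m < j" "int n dvd frog_pos c p j x - m" by blast
    then have "int n dvd frog_pos c p j x - (frog_pos c p j x - m)" using frog_pos_p[OF f mem(2)] dvd_diff by blast
    then show False using zdvd_not_zless[of m "int n"] m st by simp
  qed
  moreover have "v \<in> {c s, c j}" if "u \<in> ?S" "v \<notin> ?S" "adj u v" for u v
    using frog_arc_cut[OF f, of s j u v] that st by simp
  ultimately obtain z where z: "z \<in> set g" "z \<in> {c s, c j}"
    using walk_crosses[of g ?S "{c s, c j}"] g by (auto simp: geod_def)
  have "c s \<notin> set g" using g(2) mem xt st' by auto
  then have cj: "c j \<in> set g" using z by auto
  have V: "c r \<in> V" for r using cyc_V[OF c] .
  have xV: "x \<in> V" using mem frog_V[OF f] by simp
  have "c j \<in> set q" using frog_Int(2)[OF f] by auto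
  then have "c j \<notin> set p" using frog_Int(3)[OF f] by auto
  then have "d x (c j) = d x (c 0) + d (c 0) (c j)" by (intro frog_gate[OF f mem(2) V])
  moreover have "d (c t) (c j) + d (c j) x = d (c t) x" using geod_set[OF g(1) cj] .
  moreover have "d (c t) x \<le> d (c t) (c 0) + d (c 0) x" using dist_triangle V xV by blast
  moreover have "d x (c j) = d (c j) x" "d x (c 0) = d (c 0) x" using dist_sym V xV by blast+
  ultimately have le: "d (c t) (c j) + d (c 0) (c j) \<le> d (c t) (c 0)" by linarith
  have "int (d (c 0) (c j)) = int n div 2"
    using frog_dist[OF f, of 0 j] f by (simp add: frog_at_def)
  moreover have "2 * int (d (c t) (c 0)) \<le> int n"
    using frog_dist[OF f, of t 0] cyc_dist_half[OF n, of t] by simp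
  moreover have "1 \<le> d (c t) (c j)"
    using st by (intro dist_pos V cyc_neq[OF c]) auto
  ultimately show False using le by linarith
qed

text \<open>Positions are injective on X, so four members can be ordered cyclically. Two of them on
  the cycle cannot separate the other two. Hence \<open>x1\<close> or \<open>x3\<close> is off the
  cycle, and likewise \<open>x2\<close> or \<open>x4\<close>, each time on a tail.\<close>

lemma frog_mv_card:
  assumes f0: "frog_at n c p q j0" and X: "mv X"
  shows "card X \<le> 3"
proof (rule ccontr)
  assume "\<not> card X \<le> 3"
  then have X4: "4 \<le> card X" by simp
  then have X3: "3 \<le> card X" by simp
  note f = frog_at_mod[OF f0]
  define j where "j = j0 mod int n"
  note f = f[folded j_def]
  note c = frog_cyc[OF f]
  have n: "0 < int n" using frog_n[OF f] by simp
  have j: "0 \<le> j" "j < int n" using n by (simp_all add: j_def)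
  have qone: "x = y" if "x \<in> X" "y \<in> X" "x \<in> set q" "y \<in> set q" for x y
    using frog_tail_one[OF frog_at_swap[OF f] X X3 that] .
  have pone: "x = y" if "x \<in> X" "y \<in> X" "x \<in> set p" "y \<in> set p" for x y
    using frog_tail_one[OF f X X3 that] .
  let ?pos = "frog_pos c p j"
  define g where "g x = ?pos x mod int n" for x
  have g: "0 \<le> g x" "g x < int n" "int n dvd ?pos x - g x" for x
    using n by (simp_all add: g_def dvd_minus_mod)
  have gI: "g x = m" if "0 \<le> m" "m < int n" "int n dvd ?pos x - m" for x m
  proof -
    have "?pos x mod int n = m mod int n" using that(3) unfolding mod_eq_dvd_iff .
    then show ?thesis using that by (simp add: g_def)
  qed
  have "inj_on g X"
  proof (rule inj_onI)
    fix x y assume xy: "x \<in> X" "y \<in> X" "g x = g y"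
    then have "int n dvd ?pos x - ?pos y" by (simp add: g_def mod_eq_dvd_iff)
    then show "x = y" using frog_pos_inj[OF f X X3 qone] xy by blast
  qed
  then have "card (g ` X) = card X" by (rule card_image)
  then obtain s1 s2 s3 s4 where s: "s1 \<in> g ` X" "s2 \<in> g ` X" "s3 \<in> g ` X" "s4 \<in> g ` X"
    "s1 < s2" "s2 < s3" "s3 < s4"
    using four_ints[of "g ` X"] X4 mv_finite[OF X] by (metis finite_imageI)
  then obtain x1 x2 x3 x4 where x: "x1 \<in> X" "x2 \<in> X" "x3 \<in> X" "x4 \<in> X"
    and gx: "g x1 < g x2" "g x2 < g x3" "g x3 < g x4" by blast
  have exact: "x = c (g x)" if "x \<in> range c" for x
    using c_frog_pos[OF f that] cyc_eq_iff[OF c, of "?pos x" "g x"] g(3) by simp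
  have gp: "g x = 0" if "x \<in> set p" for x
    using gI[of 0 x] frog_pos_p[OF f that] n by simp
  have gq: "g x = j" if "x \<in> set q" for x
    using gI[of j x] frog_pos_q[OF f that] j by simp
  have XV: "x \<in> range c \<or> x \<in> set p \<or> x \<in> set q" if "x \<in> X" for x
    using that X frog_V[OF f] by (auto simp: mutual_visibility_set_def)
  have sep: False
    if ab: "a \<in> X" "b \<in> X" "a \<in> range c" "b \<in> range c" "g a < g b"
      and y: "y \<in> X" "g a < g y" "g y < g b" and z: "z \<in> X" "g z < g a \<or> g b < g z" for a b y z
  proof -
    let ?S = "{z. \<exists>m. g a < m \<and> m < g b \<and> int n dvd ?pos z - m}"
    have "y \<in> ?S" using y g by blast
    moreover have "z \<notin> ?S"
    proof
      assume "z \<in> ?S"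
      then obtain m where m: "g a < m" "m < g b" "int n dvd ?pos z - m" by blast
      then have "g z = m" using gI[of m z] g(1)[of a] g(2)[of b] by linarith
      then show False using m z by linarith
    qed
    moreover have "v \<in> {a, b}" if "u \<in> ?S" "v \<notin> ?S" "adj u v" for u v
      using frog_arc_cut[OF f ab(5) that] exact[OF ab(3)] exact[OF ab(4)] by auto
    moreover have "y \<notin> {a, b}" "z \<notin> {a, b}" using y z ab(5) by auto
    ultimately show False using mv_not_separated[OF X y(1) z(1), of ?S "{a, b}"] ab by auto
  qed
  have 13: "x1 \<notin> range c \<or> x3 \<notin> range c" using sep[of x1 x3 x2 x4] x gx by auto
  have 24: "x2 \<notin> range c \<or> x4 \<notin> range c" using sep[of x2 x4 x3 x1] x gx by auto
  \<comment> \<open>Position 0, that of \<open>p\<close>, is the least possible, so only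
    \<open>x1\<close> can lie on \<open>p\<close>.\<close>
  have np: "x2 \<notin> set p" "x3 \<notin> set p" "x4 \<notin> set p" using gp gx g(1)[of x1] by force+
  have q24: "x2 \<in> set q \<or> x4 \<in> set q" using 24 XV x np by blast
  then have "x1 \<notin> set q" "x3 \<notin> set q" using gq gx by force+
  then have p1: "x1 \<in> set p" and r3: "x3 \<in> range c" using 13 XV x np by blast+
  have gx1: "g x1 = 0" using gp p1 .
  from q24 show False
  proof
    assume q4: "x4 \<in> set q"
    then have g4: "g x4 = j" using gq by blast
    have "x2 \<notin> set q" using gq gx g4 by force
    then have "x2 \<in> range c" using XV x np by blast
    then have "c (g x2) = x2" "c (g x3) = x3" using exact r3 by metis+
    then show False
      using frog_arc_pair[OF f X, of "g x2" "g x3" x1] gx gx1 g4 j x p1 by simp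
  next
    assume q2: "x2 \<in> set q"
    then have g2: "g x2 = j" using gq by blast
    have "x4 \<notin> set q" using gq gx g2 by force
    then have r4: "x4 \<in> range c" using XV x np by blast
    \<comment> \<open>Now \<open>x3\<close> and \<open>x4\<close> lie on the arc from
      \<open>j\<close> to \<open>n\<close>; reflection turns it into the arc from 0 to
      \<open>n - j\<close>.\<close>
    have "(- j) mod int n = int n - j" using j gx gx1 g2 by (simp add: zmod_zminus1_eq_if)
    then have f': "frog_at n (\<lambda>i. c (- i)) p q (int n - j)"
      using frog_at_mod[OF frog_at_rev[OF f]] by simp
    have per: "c (- (int n - r)) = c r" for r using cyc_eq_iff[OF c] by simp
    have "c (g x4) = x4" "c (g x3) = x3" using exact r3 r4 by metis+
    then show False
      using frog_arc_pair[OF f' X, of "int n - g x4" "int n - g x3" x1] per gx gx1 g2 g(2)[of x4] x p1 by simp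
  qed
qed

lemma frog_tail_degree:
  assumes f: "frog_at n c p q j" and p: "2 \<le> length p"
  shows "3 \<le> card (nbrs (c 0))"
proof -
  note c = frog_cyc[OF f]
  have "path_adj p (c 0) (p ! 1)" using p frog_hd(3)[OF f] by (auto simp: path_adj_def intro!: exI[of _ 0])
  then have a: "adj (c 0) (p ! 1)" using frog_adj[OF f] by blast
  have "1 < length p" "0 < length p" using p by linarith+
  then have "p ! 1 \<noteq> c 0" using frog_nth_eq[OF f, of 1 0] frog_hd(3)[OF f] by simp
  moreover have "p ! 1 \<in> set p" using \<open>1 < length p\<close> by (rule nth_mem)
  ultimately have off: "p ! 1 \<notin> range c" using frog_Int(1)[OF f] by blast
  have "card {c 1, c (-1), p ! 1} \<le> card (nbrs (c 0))"
    using a cyc_adj[OF c, of 0] by (intro card_mono) auto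
  moreover have "c 1 \<noteq> c (-1)" using cyc_nbrs_distinct[OF c, of 0] by simp
  moreover have "c 1 \<noteq> p ! 1" "c (-1) \<noteq> p ! 1" using off by (metis rangeI)+
  ultimately show ?thesis by simp
qed

text \<open>A nontrivial tail gives a vertex with three neighbours. Otherwise the graph is a cycle,
  and a vertex with its two neighbours and its antipode will do.\<close>

lemma frog_ex_mv:
  assumes f: "frog_at n c p q j"
  shows "\<exists>X. mv X \<and> 3 \<le> card X"
proof -
  note c = frog_cyc[OF f]
  have n: "4 \<le> n" using frog_n[OF f] .
  consider "2 \<le> length p" | "2 \<le> length q" | "length p < 2" "length q < 2" by linarith
  then show ?thesis
  proof cases
    case 1
    then show ?thesis using frog_tail_degree[OF f] mv_nbrs by blast
  next
    case 2
    then show ?thesis using frog_tail_degree[OF frog_at_swap[OF f]] mv_nbrs by blast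
  next
    case 3
    have "p = [c 0]" "q = [c j]" using 3 frog_hd[OF f] f by (cases p; cases q; auto simp: frog_at_def)+
    then have V: "V = range c" using frog_V[OF f] by auto
    define h where "h = int n div 2"
    have h: "2 \<le> h" "2 * h \<le> int n" "int n \<le> 2 * h + 1" using n unfolding h_def by linarith+
    have D: "int (d (c i) (c k)) = cyc_dist n (i - k)" for i k using frog_dist[OF f] .
    have dh: "int (d (c 0) (c h)) = h" using D[of h 0] dist_sym[OF cyc_V[OF c] cyc_V[OF c], of 0 h] h by (simp add: cyc_dist_eq)
    have "\<not> adj (c h) (c 0)" using dist_adj[of "c 0" "c h"] adj_sym[of "c h" "c 0"] dh h by auto
    moreover have "c 0 \<noteq> c h" using h by (intro cyc_neq[OF c]) auto
    ultimately have "mv (insert (c 0) (nbrs (c h)))"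
    proof (intro mv_nbrs_insert)
      fix x assume "adj (c h) x"
      then obtain k where "x = c k" using V adj_V(2) by blast
      moreover have "2 * int (d (c 0) (c k)) \<le> int n" using D[of 0 k] cyc_dist_half[of n "0 - k"] n by simp
      ultimately show "d (c 0) x \<le> d (c 0) (c h)" using dh h by simp
    qed (use cyc_V[OF c] in auto)
    moreover have "3 \<le> card (insert (c 0) (nbrs (c h)))"
    proof -
      have "card {c (h + 1), c (h - 1)} \<le> card (nbrs (c h))"
        using cyc_adj[OF c, of h] by (intro card_mono) auto
      then show ?thesis using cyc_nbrs_distinct[OF c, of h] \<open>\<not> adj (c h) (c 0)\<close> by simp
    qed
    ultimately show ?thesis by blast
  qed
qed

lemma frog_mv_number: "frog_at n c p q j \<Longrightarrow> mutual_visibility_number G = 3"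
  using frog_ex_mv frog_mv_card card_mv_le ex_mv_number by (metis le_antisym le_trans)

text \<open>The cycle is rotated by the index \<open>i\<close> of \<open>hd p\<close>. The length
  bound rises from 3 to 4 because the ambient graph has no triangle.\<close>

lemma frog_at_if_frog_graph:
  assumes "frog_graph G"
  shows "\<exists>n c p q j. frog_at n c p q j"
proof -
  obtain xs p q where xs: "distinct xs" "3 \<le> length xs" and p: "distinct p" "p \<noteq> []" and q: "distinct q" "q \<noteq> []"
    and anti: "antipodal (cycle_graph xs) (hd p) (hd q)"
    and int: "set p \<inter> set xs = {hd p}" "set q \<inter> set xs = {hd q}" "set p \<inter> set q = {}"
    and verts: "pverts G = pverts (cycle_graph xs) \<union> pverts (path_graph p) \<union> pverts (path_graph q)"
    and arcs: "parcs G = parcs (cycle_graph xs) \<union> parcs (path_graph p) \<union> parcs (path_graph q)"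
    using assms unfolding frog_graph_def by blast
  let ?n = "length xs"
  have ne: "xs \<noteq> []" using xs by auto
  have adj: "adj x y \<longleftrightarrow> (\<exists>i. x = cyc_fun xs i \<and> y = cyc_fun xs (i + 1) \<or> x = cyc_fun xs (i + 1) \<and> y = cyc_fun xs i) \<or>
      path_adj p x y \<or> path_adj q x y" for x y
    unfolding adj_def arcs Un_iff parcs_cycle_graph[OF ne] parcs_path_graph by blast
  have cyc: "cyc ?n (cyc_fun xs)"
    unfolding cyc_def using xs cyc_fun_eq_iff[OF xs(1) ne] adj by blast
  have n: "4 \<le> ?n" using cyc_ge_4[OF cyc] .
  have r: "range (cyc_fun xs) = set xs" using range_cyc_fun[OF ne] .
  obtain i k where ik: "hd p = cyc_fun xs i" "hd q = cyc_fun xs k" using int r by (metis Int_iff insertI1 rangeE)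
  define c where "c t = cyc_fun xs (i + t)" for t
  have rc: "range c = set xs"
  proof -
    have "cyc_fun xs t = c (t - i)" for t by (simp add: c_def)
    then have "range (cyc_fun xs) \<subseteq> range c" by auto
    moreover have "range c \<subseteq> range (cyc_fun xs)" by (auto simp: c_def)
    ultimately show ?thesis using r by blast
  qed
  have adj': "(\<exists>t. x = cyc_fun xs t \<and> y = cyc_fun xs (t + 1) \<or> x = cyc_fun xs (t + 1) \<and> y = cyc_fun xs t) \<longleftrightarrow>
     (\<exists>t. x = c t \<and> y = c (t + 1) \<or> x = c (t + 1) \<and> y = c t)" (is "?L \<longleftrightarrow> ?R") for x y
  proof
    assume ?L
    then obtain t where "x = cyc_fun xs t \<and> y = cyc_fun xs (t + 1) \<or> x = cyc_fun xs (t + 1) \<and> y = cyc_fun xs t" by blast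
    then show ?R by (intro exI[of _ "t - i"]) (simp add: c_def algebra_simps)
  next
    assume ?R
    then show ?L unfolding c_def by (metis add.assoc)
  qed
  have "cyc_dist ?n (i - k) = int ?n div 2"
    using anti antipodal_cycle_graph_iff[OF xs(1) n] ik by simp
  then have "cyc_dist ?n (k - i) = int ?n div 2" by (subst cyc_dist_commute)
  moreover have "cyc ?n c" using cyc_shift[OF cyc, of i] by (simp add: c_def[abs_def])
  moreover have "pverts G = range c \<union> set p \<union> set q"
    using verts rc by (simp add: cycle_graph_def path_graph_def)
  moreover have "hd p = c 0" "hd q = c (k - i)" using ik by (simp_all add: c_def)
  ultimately have "frog_at ?n c p q (k - i)"
    unfolding frog_at_def using p q int rc adj adj' by simp
  then show ?thesis by blast
qed

end

section \<open>Assembling the frog around a shortest cycle\<close>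

context small_mv_graph
begin

lemma frog_graph_if_cyc:
  assumes "cyc m c'"
  shows "frog_graph G"
proof -
  obtain n c where sc: "shortest_cyc n c" using ex_shortest_cyc assms by blast
  note c = shortest_cyc_cyc[OF sc]
  have n: "4 \<le> n" using cyc_ge_4[OF c] .
  obtain i j where ij: "cyc_dist n (i - j) = int n div 2"
    and br: "\<And>k a. adj (c k) a \<Longrightarrow> a \<notin> range c \<Longrightarrow> c k = c i \<or> c k = c j"
    using branches_within_antipodal_pair[OF sc] by blast
  obtain p q where p: "full_tail c p" "hd p = c i" and q: "full_tail c q" "hd q = c j"
    using ex_full_tail[OF sc] by metis
  have ne: "hd p \<noteq> hd q"
  proof
    assume "hd p = hd q"
    then have "cyc_dist n (i - j) = 0" using p q cyc_eq_iff[OF c, of i j] cyc_dist_0_iff[of n "i - j"] n by simp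
    then show False using ij n by simp
  qed
  \<comment> \<open>One period of \<open>c\<close> as a list, so that \<open>cyc_fun xs\<close>
    gives back \<open>c\<close> itself.\<close>
  define xs where "xs = map (\<lambda>t. c (int t)) [0..<n]"
  have len: "length xs = n" by (simp add: xs_def)
  have xne: "xs \<noteq> []" using len n by auto
  have cf: "cyc_fun xs t = c t" for t
  proof -
    have np: "0 < int n" using n by simp
    have "nat (t mod int n) < n" using pos_mod_bound[OF np, of t] np by (simp add: nat_less_iff)
    then have "cyc_fun xs t = c (t mod int n)" using pos_mod_sign[OF np, of t] by (simp add: cyc_fun_def xs_def)
    also have "\<dots> = c t" unfolding cyc_eq_iff[OF c] by (simp add: mod_eq_dvd_iff[symmetric])
    finally show ?thesis .
  qed
  then have cfun: "cyc_fun xs = c" by (rule ext)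
  have rc: "set xs = range c" using range_cyc_fun[OF xne] cfun by simp
  have dist: "distinct xs"
    unfolding distinct_conv_nth xs_def using cyc_neq[OF c] by auto
  have hp: "p \<noteq> []" "distinct p" "set p \<inter> range c = {hd p}" if "full_tail c p" for p
  proof -
    have t: "tail c p" using that by (simp add: full_tail_def[OF sc])
    then show "p \<noteq> []" "distinct p" by (simp_all add: tail_def)
    show "set p \<inter> range c = {hd p}" using t by (cases p) (auto simp: tail_def)
  qed
  let ?E = "parcs (cycle_graph xs) \<union> parcs (path_graph p) \<union> parcs (path_graph q)"
  let ?W = "range c \<union> set p \<union> set q"
  have E: "(x, y) \<in> ?E \<longleftrightarrow> (\<exists>i. x = c i \<and> y = c (i + 1) \<or> x = c (i + 1) \<and> y = c i) \<or>
      path_adj p x y \<or> path_adj q x y" for x y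
    unfolding Un_iff parcs_cycle_graph[OF xne] parcs_path_graph cfun by blast
  have path: "path_adj r x y" if r: "full_tail c r" "x \<in> set r" "x \<notin> range c" "adj x y" for r x y
  proof -
    have t: "tail c r" using r by (simp add: full_tail_def[OF sc])
    obtain t where t: "t < length r" "x = r ! t" using r by (auto simp: in_set_conv_nth)
    have "t \<noteq> 0" using t r(3) tail_nth_0[OF sc \<open>tail c r\<close>] \<open>tail c r\<close> by (auto simp: tail_def)
    then have "y = r ! (t - 1) \<or> (Suc t < length r \<and> y = r ! Suc t)"
      using full_tail_nbrs[OF sc r(1), of t y] t r(4) by simp
    then show ?thesis
    proof
      assume "y = r ! (t - 1)"
      then show ?thesis using t \<open>t \<noteq> 0\<close> unfolding path_adj_def by (intro exI[of _ "t - 1"]) simp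
    next
      assume "Suc t < length r \<and> y = r ! Suc t"
      then show ?thesis using t unfolding path_adj_def by (intro exI[of _ t]) simp
    qed
  qed
  have root: "path_adj r (hd r) y" if r: "full_tail c r" "adj (hd r) y" "y \<notin> range c" for r y
    using full_tail_root[OF sc r] hp[OF r(1)] unfolding path_adj_def
    by (intro exI[of _ 0]) (simp add: hd_conv_nth)
  have AE: "(x, y) \<in> ?E" if x: "x \<in> ?W" and xy: "adj x y" for x y
  proof -
    consider k l where "x = c k" "y = c l" | k where "x = c k" "y \<notin> range c"
      | "x \<in> set p" "x \<notin> range c" | "x \<in> set q" "x \<notin> range c"
      using x by blast
    then show ?thesis
    proof cases
      case (1 k l)
      then have "c l = c (k + 1) \<or> c l = c (k - 1)" using shortest_cyc_chordless[OF sc] xy by blast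
      moreover have "c k = c ((k - 1) + 1)" by simp
      ultimately show ?thesis using 1 unfolding E by metis
    next
      case (2 k)
      then have "x = hd p \<or> x = hd q" using br[of k y] xy p q by simp
      then show ?thesis using root[OF p(1), of y] root[OF q(1), of y] xy 2 unfolding E by blast
    next
      case 3
      then show ?thesis using path[OF p(1) _ _ xy] unfolding E by blast
    next
      case 4
      then show ?thesis using path[OF q(1) _ _ xy] unfolding E by blast
    qed
  qed
  have EW: "y \<in> ?W" if "(x, y) \<in> ?E" for x y
    using that path_adj_set(2) unfolding E by fastforce
  have pathE: "adj x y" if r: "full_tail c r" and "path_adj r x y" for r x y
  proof -
    have "tail c r" using r by (simp add: full_tail_def[OF sc])
    then show ?thesis using tail_nth_adj[OF sc] adj_sym that(2) unfolding path_adj_def by metis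
  qed
  have EA: "adj x y" if "(x, y) \<in> ?E" for x y
    using that unfolding E using cyc_adj(1)[OF c] adj_sym pathE[OF p(1)] pathE[OF q(1)] by metis
  have pV: "set r \<subseteq> V" if r: "full_tail c r" for r
  proof
    fix x assume "x \<in> set r"
    then obtain t where t: "t < length r" "x = r ! t" by (auto simp: in_set_conv_nth)
    have tr: "tail c r" using r by (simp add: full_tail_def[OF sc])
    show "x \<in> V"
    proof (cases t)
      case 0
      then show ?thesis using t tail_nth_0[OF sc tr] tr cyc_V[OF c] by (auto simp: tail_def)
    next
      case (Suc u)
      then show ?thesis using t tail_nth_adj[OF sc tr, of u] adj_V by blast
    qed
  qed
  have VW: "V = ?W"
  proof
    show "?W \<subseteq> V" using pV p q cyc_V[OF c] by blast
    show "V \<subseteq> ?W"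
    proof
      fix y assume "y \<in> V"
      then obtain g where g: "walk g" "hd g = c 0" "last g = y" using ex_walk cyc_V[OF c] by blast
      show "y \<in> ?W"
      proof (rule ccontr)
        assume "y \<notin> ?W"
        \<comment> \<open>Every edge from \<open>?W\<close> is among the listed ones and ends in
          \<open>?W\<close> again, so the crossing set may be taken empty; connectedness then leaves
          no further vertex.\<close>
        then have "\<exists>z\<in>set g. z \<in> {}"
          using g AE EW by (intro walk_crosses[of g ?W]) blast+
        then show False by simp
      qed
    qed
  qed
  have "parcs G = ?E"
  proof (intro equalityI subrelI)
    fix x y assume xy: "(x, y) \<in> parcs G"
    then have "adj x y" by (simp add: adj_def)
    then show "(x, y) \<in> ?E" using AE VW adj_V(1) by blast
  next
    fix x y assume "(x, y) \<in> ?E"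
    then show "(x, y) \<in> parcs G" using EA adj_def by blast
  qed
  moreover have "pverts G = pverts (cycle_graph xs) \<union> pverts (path_graph p) \<union> pverts (path_graph q)"
    using VW rc by (simp add: cycle_graph_def path_graph_def)
  moreover have "antipodal (cycle_graph xs) (hd p) (hd q)"
    using antipodal_cycle_graph_iff[OF dist, of i j] n ij p q by (simp add: cfun len)
  moreover have "set p \<inter> set q = {}" using full_tails_disjoint[OF sc p(1) q(1) ne] .
  ultimately show ?thesis unfolding frog_graph_def
    using dist len n hp[OF p(1)] hp[OF q(1)] rc by (intro exI[of _ xs] exI[of _ p] exI[of _ q]) simp
qed

end

theorem theorem4p4:
  fixes G :: "'a pair_pre_digraph"
  assumes "pair_graph G"
    and "connected (with_proj G)"
    and "triangle_free G"
  shows "mutual_visibility_number G = 3 \<longleftrightarrow>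
    (undirected_tree G \<and> card (leaves G) = 3) \<or> frog_graph G"
proof -
  interpret conn_graph G using assms by (rule conn_graph.intro)
  have "frog_graph G" if \<mu>: "mutual_visibility_number G = 3" and cyclic: "\<not> undirected_tree G"
  proof -
    interpret small_mv_graph G
      using card_mv_le \<mu> by unfold_locales simp
    show ?thesis using frog_graph_if_cyc cyclic undirected_tree_iff by blast
  qed
  moreover have "mutual_visibility_number G = 3 \<longleftrightarrow> card (leaves G) = 3" if "undirected_tree G"
    using tree_mv_number_iff that undirected_tree_iff by blast
  moreover have "mutual_visibility_number G = 3" if "frog_graph G"
    using frog_at_if_frog_graph[OF that] frog_mv_number by blast
  ultimately show ?thesis by blast
qed

end
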